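(* Let $Q$ be a smooth $n$-manifold, let $L\in C^\infty(T^1_kQ)$ be a regular Lagrangian and let $\mathbf\Gamma=(\Gamma_1,\dots,\Gamma_k)$ be a SOPDE on $T^1_kQ$. Then the following are equivalent: (i) $\mathbf\Gamma$ is Lagrangian for $L$; (ii) for each vector field $Z$ on $Q$, $\ \Gamma_\alpha(Z^{V_\alpha}(L))-Z^C(L)=0$ (sum over $\alpha$); (iii) for each local frame $\{Z_A\}$ of vector fields on $Q$, $\ \Gamma_\alpha(Z_A^{V_\alpha}(L))-Z_A^C(L)=0$ for $A=1,\dots,n$.
   Context: Everything is smooth; repeated indices (including $\alpha,\beta=1,\dots,k$) are summed. $T^1_kQ=TQ\oplus\cdots\oplus TQ$ ($k$ copies) with projection $\tau^1_Q:T^1_kQ\to Q$. Coordinates $(q^A)$ on $Q$ induce coordinates $(q^A,u^A_\alpha)$ on $T^1_kQ$. For a vector field $Z=Z^A\partial/\partial q^A$ on $Q$, its $\alpha$-th vertical lift and its complete lift to $T^1_kQ$ are $$Z^{V_\alpha}=Z^A\frac{\partial}{\partial u^A_\alpha},\qquad Z^C=Z^A\frac{\partial}{\partial q^A}+u^A_\alpha\frac{\partial Z^B}{\partial q^A}\frac{\partial}{\partial u^B_\alpha}.$$ A local frame on $Q$ is a local basis $\{Z_A\}_{A=1}^n$ of vector fields. A $k$-vector field on $T^1_kQ$ is a $k$-tuple of vector fields on $T^1_kQ$. It is a SOPDE (second-order partial differential equation field) if $T_{\mathbf w}\tau^1_Q(\Gamma_\alpha(\mathbf w))=w_\alpha$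 for all $\mathbf w=(w_1,\dots,w_k)\in T^1_kQ$ and all $\alpha$; in coordinates $\Gamma_\alpha=u^A_\alpha\partial/\partial q^A+(f_\alpha)^B_\beta\partial/\partial u^B_\beta$. $L$ is regular if the $nk\times nk$ matrix $\left(\frac{\partial^2L}{\partial u^A_\alpha\partial u^B_\beta}\right)$ is non-singular everywhere. Put $\theta^\alpha_L=dL\circ S^\alpha$ with $S^\alpha=\frac{\partial}{\partial u^A_\alpha}\otimes dq^A$, so $\theta_L^\alpha=\frac{\partial L}{\partial u^A_\alpha}dq^A$. A SOPDE $\mathbf\Gamma$ is called Lagrangian for $L$ if $\mathcal L_{\Gamma_\alpha}\theta^\alpha_L-dL=0$ (sum over $\alpha$). *)

theory Defs
  imports "HOL-Analysis.Analysis"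
begin

section \<open>Smooth maps between Euclidean spaces\<close>

text \<open>Only used on open sets \<open>S\<close>, where the derivative at a point is determined by \<open>f\<close> on \<open>S\<close>.\<close>

primrec Ck_on :: "nat \<Rightarrow> 'a::real_normed_vector set \<Rightarrow> ('a \<Rightarrow> 'b::real_normed_vector) \<Rightarrow> bool" where
  "Ck_on 0 S f \<longleftrightarrow> continuous_on S f"
| "Ck_on (Suc m) S f \<longleftrightarrow>
     (\<forall>x\<in>S. f differentiable (at x)) \<and> (\<forall>v. Ck_on m S (\<lambda>x. frechet_derivative f (at x) v))"

definition smooth_on :: "'a::real_normed_vector set \<Rightarrow> ('a \<Rightarrow> 'b::real_normed_vector) \<Rightarrow> bool" where
  "smooth_on S f \<longleftrightarrow> (\<forall>m. Ck_on m S f)"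

section \<open>Smooth manifolds\<close>

text \<open>
  A manifold is the union of its chart domains, and its topology is the one determined by the
  charts.  The charts are indexed by a type \<open>'i\<close>; charts with empty domain are allowed, so every
  set of charts (a maximal atlas, for instance) can be presented in this way.
\<close>

record ('m, 'i, 'e) atlas =
  chart_dom :: "'i \<Rightarrow> 'm set"
  chart_map :: "'i \<Rightarrow> 'm \<Rightarrow> 'e"

definition points :: "('m, 'i, 'e) atlas \<Rightarrow> 'm set" where
  "points M = (\<Union>i. chart_dom M i)"

definition chart_inv :: "('m, 'i, 'e) atlas \<Rightarrow> 'i \<Rightarrow> 'e \<Rightarrow> 'm" where
  "chart_inv M i = inv_into (chart_dom M i) (chart_map M i)"

definition transition :: "('m, 'i, 'e) atlas \<Rightarrow> 'i \<Rightarrow> 'i \<Rightarrow> 'e \<Rightarrow> 'e" where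
  "transition M i j = (\<lambda>x. chart_map M j (chart_inv M i x))"

definition atlas_topology :: "('m, 'i, 'e::euclidean_space) atlas \<Rightarrow> 'm topology" where
  "atlas_topology M =
     topology_generated_by {{p \<in> chart_dom M i. chart_map M i p \<in> V} | i V. open V}"

definition smooth_manifold :: "('m, 'i, 'e::euclidean_space) atlas \<Rightarrow> bool" where
  "smooth_manifold M \<longleftrightarrow>
     (\<forall>i. inj_on (chart_map M i) (chart_dom M i)) \<and>
     (\<forall>i j. open (chart_map M i ` (chart_dom M i \<inter> chart_dom M j))) \<and>
     (\<forall>i j. smooth_on (chart_map M i ` (chart_dom M i \<inter> chart_dom M j)) (transition M i j)) \<and>
     Hausdorff_space (atlas_topology M) \<and>
     second_countable (atlas_topology M)"

text \<open>Some chart around \<open>p\<close>.  The pointwise notions below do not depend on this choice.\<close>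

definition chart_at :: "('m, 'i, 'e) atlas \<Rightarrow> 'm \<Rightarrow> 'i" where
  "chart_at M p = (SOME i. p \<in> chart_dom M i)"

definition smooth_function :: "('m, 'i, 'e::euclidean_space) atlas \<Rightarrow> ('m \<Rightarrow> real) \<Rightarrow> bool" where
  "smooth_function M f \<longleftrightarrow>
     (\<forall>i. smooth_on (chart_map M i ` chart_dom M i) (\<lambda>x. f (chart_inv M i x)))"

text \<open>
  A tangent vector at \<open>p\<close> is represented by the family of its components in all the charts around
  \<open>p\<close>, which are related by the Jacobians of the transition maps.  The components in the remaining
  charts are set to zero, so that equal tangent vectors are equal as functions.
\<close>

definition tangent_space :: "('m, 'i, 'e::euclidean_space) atlas \<Rightarrow> 'm \<Rightarrow> ('i \<Rightarrow> 'e) set" where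
  "tangent_space M p =
     {v. (\<forall>i. p \<notin> chart_dom M i \<longrightarrow> v i = 0) \<and>
         (\<forall>i j. p \<in> chart_dom M i \<inter> chart_dom M j \<longrightarrow>
            v j = frechet_derivative (transition M i j) (at (chart_map M i p)) (v i))}"

text \<open>The tangent vector at \<open>p\<close> whose components in chart \<open>i\<close> are \<open>e\<close>.\<close>

definition tangent_of :: "('m, 'i, 'e::euclidean_space) atlas \<Rightarrow> 'i \<Rightarrow> 'm \<Rightarrow> 'e \<Rightarrow> 'i \<Rightarrow> 'e" where
  "tangent_of M i p e = (\<lambda>j.
     if p \<in> chart_dom M j
     then frechet_derivative (transition M i j) (at (chart_map M i p)) e else 0)"

text \<open>A smooth vector field on the open subset \<open>W\<close>; its values outside \<open>W\<close> are irrelevant.\<close>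

definition vector_field_on ::
    "('m, 'i, 'e::euclidean_space) atlas \<Rightarrow> 'm set \<Rightarrow> ('m \<Rightarrow> 'i \<Rightarrow> 'e) \<Rightarrow> bool" where
  "vector_field_on M W X \<longleftrightarrow>
     openin (atlas_topology M) W \<and>
     (\<forall>p\<in>W. X p \<in> tangent_space M p) \<and>
     (\<forall>i. smooth_on (chart_map M i ` (chart_dom M i \<inter> W)) (\<lambda>x. X (chart_inv M i x) i))"

definition local_frame ::
    "('m, 'i, real^'n) atlas \<Rightarrow> 'm set \<Rightarrow> ('n \<Rightarrow> 'm \<Rightarrow> 'i \<Rightarrow> real^'n) \<Rightarrow> bool" where
  "local_frame M W Z \<longleftrightarrow>
     (\<forall>A. vector_field_on M W (Z A)) \<and>
     (\<forall>p\<in>W. \<forall>v\<in>tangent_space M p. \<exists>!c::'n \<Rightarrow> real. v = (\<lambda>i. \<Sum>A\<in>UNIV. c A *\<^sub>R Z A p i))"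

definition differential ::
    "('m, 'i, 'e::euclidean_space) atlas \<Rightarrow> ('m \<Rightarrow> real) \<Rightarrow> 'm \<Rightarrow> ('i \<Rightarrow> 'e) \<Rightarrow> real" where
  "differential M f p v = (let i = chart_at M p in
     frechet_derivative (\<lambda>x. f (chart_inv M i x)) (at (chart_map M i p)) (v i))"

text \<open>The function \<open>X(f)\<close>.\<close>

definition apply_field ::
    "('m, 'i, 'e::euclidean_space) atlas \<Rightarrow> ('m \<Rightarrow> 'i \<Rightarrow> 'e) \<Rightarrow> ('m \<Rightarrow> real) \<Rightarrow> 'm \<Rightarrow> real" where
  "apply_field M X f = (\<lambda>p. differential M f p (X p))"

definition tangent_map ::
    "('m, 'i, 'e::euclidean_space) atlas \<Rightarrow> ('p, 'j, 'f::euclidean_space) atlas \<Rightarrow> ('m \<Rightarrow> 'p) \<Rightarrow>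
     'm \<Rightarrow> ('i \<Rightarrow> 'e) \<Rightarrow> 'j \<Rightarrow> 'f" where
  "tangent_map M N F p v = (let i = chart_at M p in (\<lambda>j.
     if F p \<in> chart_dom N j
     then frechet_derivative (\<lambda>x. chart_map N j (F (chart_inv M i x))) (at (chart_map M i p)) (v i)
     else 0))"

text \<open>
  One-forms are functions of a point and a tangent vector at that point.  The Lie derivative is
  given by the usual coordinate expression
  \<open>(L\<^sub>X \<theta>)\<^sub>b = X\<^sup>a (\<partial>\<theta>\<^sub>b / \<partial>x\<^sup>a) + \<theta>\<^sub>a (\<partial>X\<^sup>a / \<partial>x\<^sup>b)\<close>, contracted with \<open>v\<^sup>b\<close>.
  In the first summand the components of \<open>v\<close> are held constant along the chart; in the second,
  \<open>v\<^sup>b (\<partial>X\<^sup>a / \<partial>x\<^sup>b)\<close> is inserted into \<open>\<theta>\<close> at \<open>p\<close>.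
\<close>

definition lie_derivative ::
    "('m, 'i, 'e::euclidean_space) atlas \<Rightarrow> ('m \<Rightarrow> 'i \<Rightarrow> 'e) \<Rightarrow> ('m \<Rightarrow> ('i \<Rightarrow> 'e) \<Rightarrow> real) \<Rightarrow>
     'm \<Rightarrow> ('i \<Rightarrow> 'e) \<Rightarrow> real" where
  "lie_derivative M X \<theta> p v = (let i = chart_at M p; x = chart_map M i p in
     frechet_derivative
       (\<lambda>y. \<theta> (chart_inv M i y) (tangent_of M i (chart_inv M i y) (v i))) (at x) (X p i)
     + \<theta> p (tangent_of M i p (frechet_derivative (\<lambda>y. X (chart_inv M i y) i) (at x) (v i))))"

section \<open>The bundle of k-tuples of tangent vectors\<close>

text \<open>
  A point \<open>(q, w)\<close> consists of \<open>q\<close> in \<open>Q\<close> and tangent vectors \<open>w \<alpha>\<close> at \<open>q\<close>, where \<open>\<alpha>\<close> ranges over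
  the finite type \<open>'k\<close>.  The projection to \<open>Q\<close> is \<^const>\<open>fst\<close>.  Chart \<open>i\<close> of \<open>Q\<close> induces chart \<open>i\<close>
  of the bundle, with coordinates \<open>(q\<^sup>A, u\<^sup>A\<^sub>\<alpha>)\<close>, where \<open>u\<^sup>A\<^sub>\<alpha>\<close> is stored as \<open>u $ \<alpha> $ A\<close>.
\<close>

type_synonym ('q, 'i, 'n, 'k) t1k = "'q \<times> ('k \<Rightarrow> 'i \<Rightarrow> real^'n)"
type_synonym ('n, 'k) t1k_coords = "(real^'n) \<times> ((real^'n)^'k)"

definition T1k ::
    "('q, 'i, real^'n) atlas \<Rightarrow> (('q, 'i, 'n, 'k::finite) t1k, 'i, ('n, 'k) t1k_coords) atlas" where
  "T1k Q = \<lparr>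
     chart_dom = (\<lambda>i. {(q, w). q \<in> chart_dom Q i \<and> (\<forall>\<alpha>. w \<alpha> \<in> tangent_space Q q)}),
     chart_map = (\<lambda>i (q, w). (chart_map Q i q, \<chi> \<alpha>. w \<alpha> i)) \<rparr>"

definition vertical_lift ::
    "('q, 'i, real^'n) atlas \<Rightarrow> 'k::finite \<Rightarrow> ('q \<Rightarrow> 'i \<Rightarrow> real^'n) \<Rightarrow>
     ('q, 'i, 'n, 'k) t1k \<Rightarrow> 'i \<Rightarrow> ('n, 'k) t1k_coords" where
  "vertical_lift Q \<alpha> Z = (\<lambda>(q, w) i.
     if q \<in> chart_dom Q i then (0, \<chi> \<beta>. if \<beta> = \<alpha> then Z q i else 0) else 0)"

definition complete_lift ::
    "('q, 'i, real^'n) atlas \<Rightarrow> ('q \<Rightarrow> 'i \<Rightarrow> real^'n) \<Rightarrow>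
     ('q, 'i, 'n, 'k::finite) t1k \<Rightarrow> 'i \<Rightarrow> ('n, 'k) t1k_coords" where
  "complete_lift Q Z = (\<lambda>(q, w) i.
     if q \<in> chart_dom Q i
     then (Z q i,
           \<chi> \<alpha>. frechet_derivative (\<lambda>x. Z (chart_inv Q i x) i) (at (chart_map Q i q)) (w \<alpha> i))
     else 0)"

definition SOPDE ::
    "('q, 'i, real^'n) atlas \<Rightarrow>
     ('k \<Rightarrow> ('q, 'i, 'n, 'k::finite) t1k \<Rightarrow> 'i \<Rightarrow> ('n, 'k) t1k_coords) \<Rightarrow> bool" where
  "SOPDE Q \<Gamma> \<longleftrightarrow>
     (\<forall>\<alpha>. vector_field_on (T1k Q) (points (T1k Q)) (\<Gamma> \<alpha>)) \<and>
     (\<forall>\<alpha>. \<forall>w\<in>points (T1k Q). tangent_map (T1k Q) Q fst w (\<Gamma> \<alpha> w) = snd w \<alpha>)"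

text \<open>The coordinate direction \<open>\<partial>/\<partial>u\<^sup>A\<^sub>\<alpha>\<close>, indexed by the pair \<open>(A, \<alpha>)\<close>.\<close>

definition fibre_basis :: "'n::finite \<times> 'k::finite \<Rightarrow> ('n, 'k) t1k_coords" where
  "fibre_basis a = (0, axis (snd a) (axis (fst a) 1))"

definition fibre_hessian ::
    "('q, 'i, real^'n) atlas \<Rightarrow> (('q, 'i, 'n, 'k::finite) t1k \<Rightarrow> real) \<Rightarrow>
     'i \<Rightarrow> ('n, 'k) t1k_coords \<Rightarrow> real^('n \<times> 'k)^('n \<times> 'k)" where
  "fibre_hessian Q L i x = (\<chi> a b.
     frechet_derivative
       (\<lambda>y. frechet_derivative (\<lambda>z. L (chart_inv (T1k Q) i z)) (at y) (fibre_basis b))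
       (at x) (fibre_basis a))"

definition regular_lagrangian ::
    "('q, 'i, real^'n) atlas \<Rightarrow> (('q, 'i, 'n, 'k::finite) t1k \<Rightarrow> real) \<Rightarrow> bool" where
  "regular_lagrangian Q L \<longleftrightarrow>
     (\<forall>i. \<forall>w\<in>chart_dom (T1k Q) i. invertible (fibre_hessian Q L i (chart_map (T1k Q) i w)))"

text \<open>The tensor field \<open>S\<^sup>\<alpha> = \<partial>/\<partial>u\<^sup>A\<^sub>\<alpha> \<otimes> dq\<^sup>A\<close> as an endomorphism of tangent spaces.\<close>

definition S_tensor ::
    "'k::finite \<Rightarrow> ('i \<Rightarrow> ('n::finite, 'k) t1k_coords) \<Rightarrow> 'i \<Rightarrow> ('n, 'k) t1k_coords" where
  "S_tensor \<alpha> v = (\<lambda>i. (0, \<chi> \<beta>. if \<beta> = \<alpha> then fst (v i) else 0))"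

definition theta ::
    "('q, 'i, real^'n) atlas \<Rightarrow> (('q, 'i, 'n, 'k::finite) t1k \<Rightarrow> real) \<Rightarrow> 'k \<Rightarrow>
     ('q, 'i, 'n, 'k) t1k \<Rightarrow> ('i \<Rightarrow> ('n, 'k) t1k_coords) \<Rightarrow> real" where
  "theta Q L \<alpha> w v = differential (T1k Q) L w (S_tensor \<alpha> v)"

definition lagrangian_for ::
    "('q, 'i, real^'n) atlas \<Rightarrow> (('q, 'i, 'n, 'k::finite) t1k \<Rightarrow> real) \<Rightarrow>
     ('k \<Rightarrow> ('q, 'i, 'n, 'k) t1k \<Rightarrow> 'i \<Rightarrow> ('n, 'k) t1k_coords) \<Rightarrow> bool" where
  "lagrangian_for Q L \<Gamma> \<longleftrightarrow>
     (\<forall>w\<in>points (T1k Q). \<forall>v\<in>tangent_space (T1k Q) w.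
        (\<Sum>\<alpha>\<in>UNIV. lie_derivative (T1k Q) (\<Gamma> \<alpha>) (theta Q L \<alpha>) w v)
          - differential (T1k Q) L w v = 0)"

end

theory Submission
  imports Defs
begin

text \<open>
  All three conditions say that the Euler--Lagrange expression
  \<open>(\<Gamma>\<^sub>\<alpha> (\<partial>L/\<partial>u\<^sup>A\<^sub>\<alpha>) - \<partial>L/\<partial>q\<^sup>A) a\<^sup>A\<close>, which is linear in \<open>a\<close>, vanishes for certain \<open>a\<close>.  For (i), \<open>a\<close> is the
  base component of an arbitrary tangent vector, because \<open>\<Gamma>\<^sub>\<alpha>\<close> has base component \<open>u\<^sub>\<alpha>\<close> and so the terms
  \<open>\<partial>L/\<partial>u\<^sup>A\<^sub>\<alpha>\<close> times \<open>du\<^sup>A\<^sub>\<alpha>\<close> cancel.  For (ii) and (iii), \<open>a = Z(q)\<close>, because the derivatives of \<open>Z\<close> along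
  \<open>u\<^sub>\<alpha>\<close> in \<open>\<Gamma>\<^sub>\<alpha>(Z\<^sup>V L)\<close> and in \<open>Z\<^sup>C(L)\<close> cancel.  Conversely, bump functions give a global field with a
  prescribed value at a point, and coordinate frames span the tangent space.
\<close>

section \<open>Calculus of smooth maps\<close>

lemmas frechet_derivative_worksI = frechet_derivative_works[THEN iffD1]

text \<open>\<open>frechet_derivative\<close> chooses among the derivatives at a point. Functions
  that agree near \<open>x\<close> have the same derivatives there, so the same choice is made, even
  where no derivative exists.\<close>

lemma frechet_derivative_cong_open:
  assumes "open S" "x \<in> S" "\<And>y. y \<in> S \<Longrightarrow> f y = g y"
  shows "frechet_derivative f (at x) = frechet_derivative g (at x)"
proof -
  have "(f has_derivative f') (at x) \<longleftrightarrow> (g has_derivative f') (at x)" for f'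
    using assms has_derivative_transform_within_open[of f f' x UNIV S g]
      has_derivative_transform_within_open[of g f' x UNIV S f] by (metis (full_types))
  then show ?thesis
    by (simp add: frechet_derivative_def)
qed

lemma differentiable_cong_open:
  assumes "open S" "x \<in> S" "\<And>y. y \<in> S \<Longrightarrow> f y = g y" "f differentiable (at x)"
  shows "g differentiable (at x)"
  using assms has_derivative_transform_within_open[of f _ x UNIV S g]
  unfolding differentiable_def by metis

text \<open>Trades a derivative in a varying direction for derivatives in fixed directions, the only
  ones of which \<open>Ck_on\<close> speaks.\<close>

lemma frechet_derivative_apply_basis:
  fixes f :: "'a::euclidean_space \<Rightarrow> 'b::real_normed_vector"
  assumes "f differentiable (at x)"
  shows "frechet_derivative f (at x) v = (\<Sum>b\<in>Basis. (v \<bullet> b) *\<^sub>R frechet_derivative f (at x) b)"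
  by (subst euclidean_representation[of v, symmetric])
    (simp add: linear_sum[OF linear_frechet_derivative[OF assms]]
      linear_cmul[OF linear_frechet_derivative[OF assms]])

section \<open>Closure properties of maps of class C^m\<close>

lemma Ck_on_cong:
  assumes "open S" "\<And>x. x \<in> S \<Longrightarrow> f x = g x"
  shows "Ck_on m S f \<longleftrightarrow> Ck_on m S g"
  using assms(2)
proof (induction m arbitrary: f g)
  case 0
  then show ?case by (simp cong: continuous_on_cong)
next
  case (Suc m)
  have "f differentiable (at x) \<longleftrightarrow> g differentiable (at x)" if "x \<in> S" for x
    using differentiable_cong_open[OF assms(1) that] Suc.prems by metis
  moreover have "Ck_on m S (\<lambda>x. frechet_derivative f (at x) v) \<longleftrightarrow>
      Ck_on m S (\<lambda>x. frechet_derivative g (at x) v)" for v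
    by (intro Suc.IH) (simp add: frechet_derivative_cong_open[OF assms(1) _ Suc.prems])
  ultimately show ?case by auto
qed

lemma Ck_on_Suc_imp: "Ck_on (Suc m) S f \<Longrightarrow> Ck_on m S f"
proof (induction m arbitrary: f)
  case 0
  then show ?case
    by (auto intro!: continuous_at_imp_continuous_on differentiable_imp_continuous_within)
next
  case (Suc m)
  then show ?case by (metis Ck_on.simps(2))
qed

lemma Ck_on_subset: "Ck_on m S f \<Longrightarrow> T \<subseteq> S \<Longrightarrow> Ck_on m T f"
  by (induction m arbitrary: f) (auto intro: continuous_on_subset)

text \<open>Differentiability is required with respect to full neighbourhoods and is thus pointwise;
  openness of the pieces serves to glue continuity. Used to extend a cut-off field by zero.\<close>

lemma Ck_on_Union:
  assumes "\<And>T. T \<in> \<T> \<Longrightarrow> open T" "\<And>T. T \<in> \<T> \<Longrightarrow> Ck_on m T f"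
  shows "Ck_on m (\<Union>\<T>) f"
  using assms(2)
proof (induction m arbitrary: f)
  case 0
  then show ?case using continuous_on_open_UN[of \<T> "\<lambda>T. T" f] assms(1) by auto
next
  case (Suc m)
  then show ?case by auto
qed

lemma Ck_on_const: "Ck_on m S (\<lambda>x. c)"
  by (induction m arbitrary: c) auto

lemma Ck_on_bounded_linear:
  assumes "bounded_linear f"
  shows "Ck_on m S f"
proof (cases m)
  case 0
  then show ?thesis using assms by (simp add: linear_continuous_on)
next
  case (Suc k)
  have "(f has_derivative f) (at x)" for x
    using assms by (rule bounded_linear_imp_has_derivative)
  then have "f differentiable (at x)" "frechet_derivative f (at x) = f" for x
    by (auto simp: differentiable_def simp flip: frechet_derivative_at)
  then show ?thesis using Suc by (simp add: Ck_on_const)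
qed

lemma Ck_on_add:
  assumes "open S" "Ck_on m S f" "Ck_on m S g"
  shows "Ck_on m S (\<lambda>x. f x + g x)"
  using assms(2,3)
proof (induction m arbitrary: f g)
  case 0
  then show ?case by (auto intro: continuous_on_add)
next
  case (Suc m)
  have D: "((\<lambda>x. f x + g x) has_derivative
      (\<lambda>v. frechet_derivative f (at x) v + frechet_derivative g (at x) v)) (at x)" if "x \<in> S" for x
    using Suc.prems that by (intro has_derivative_add) (auto simp: frechet_derivative_worksI)
  have "Ck_on m S (\<lambda>x. frechet_derivative (\<lambda>x. f x + g x) (at x) v)" for v
  proof (subst Ck_on_cong[OF assms(1)])
    show "frechet_derivative (\<lambda>x. f x + g x) (at x) v =
        frechet_derivative f (at x) v + frechet_derivative g (at x) v" if "x \<in> S" for x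
      using frechet_derivative_at[OF D[OF that]] by metis
  qed (use Suc in auto)
  then show ?case using D by (auto simp: differentiable_def)
qed

lemma Ck_on_sum:
  assumes "open S" "\<And>b. b \<in> B \<Longrightarrow> Ck_on m S (f b)"
  shows "Ck_on m S (\<lambda>x. \<Sum>b\<in>B. f b x)"
  using assms(2)
  by (induction B rule: infinite_finite_induct) (auto intro: Ck_on_const Ck_on_add[OF assms(1)])

lemma (in bounded_bilinear) Ck_on_prod:
  assumes "open S" "Ck_on m S f" "Ck_on m S g"
  shows "Ck_on m S (\<lambda>x. prod (f x) (g x))"
  using assms(2,3)
proof (induction m arbitrary: f g)
  case 0
  then show ?case by (auto intro: continuous_on)
next
  case (Suc m)
  have D: "((\<lambda>x. prod (f x) (g x)) has_derivative
      (\<lambda>v. prod (f x) (frechet_derivative g (at x) v) + prod (frechet_derivative f (at x) v) (g x)))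
      (at x)" if "x \<in> S" for x
    using Suc.prems that by (intro FDERIV) (auto simp: frechet_derivative_worksI)
  have "Ck_on m S (\<lambda>x. frechet_derivative (\<lambda>x. prod (f x) (g x)) (at x) v)" for v
  proof (subst Ck_on_cong[OF assms(1)])
    show "frechet_derivative (\<lambda>x. prod (f x) (g x)) (at x) v =
        prod (f x) (frechet_derivative g (at x) v) + prod (frechet_derivative f (at x) v) (g x)"
      if "x \<in> S" for x
      using frechet_derivative_at[OF D[OF that]] by metis
    \<comment> \<open>In each summand one factor has lost a derivative and the other is weakened to
      order \<open>m\<close>, so the induction hypothesis covers both.\<close>
    show "Ck_on m S (\<lambda>x. prod (f x) (frechet_derivative g (at x) v) +
        prod (frechet_derivative f (at x) v) (g x))"
      using Suc.prems Suc.prems[THEN Ck_on_Suc_imp]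
      by (intro Ck_on_add[OF assms(1)] Suc.IH) auto
  qed
  then show ?case using D by (auto simp: differentiable_def)
qed

text \<open>Induction with \<open>f\<close> fixed and \<open>g\<close> arbitrary: by the chain rule,
  written in a basis, the derivative is a sum of products of components of the derivative of
  \<open>f\<close> with partial derivatives of \<open>g\<close> composed with
  \<open>f\<close>.\<close>

lemma Ck_on_compose:
  fixes f :: "'a::real_normed_vector \<Rightarrow> 'b::euclidean_space"
  assumes "open S" "f ` S \<subseteq> T" "Ck_on m S f" "Ck_on m T g"
  shows "Ck_on m S (\<lambda>x. g (f x))"
  using assms(3,4)
proof (induction m arbitrary: g)
  case 0
  then show ?case using assms(2) continuous_on_compose2[of T g S f] by auto
next
  case (Suc m)
  have df: "f differentiable (at x)" and dg: "g differentiable (at (f x))" if "x \<in> S" for x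
    using Suc.prems assms(2) that by auto
  have D: "((\<lambda>x. g (f x)) has_derivative
      (\<lambda>v. frechet_derivative g (at (f x)) (frechet_derivative f (at x) v))) (at x)"
    if "x \<in> S" for x
    using frechet_derivative_worksI[OF df[OF that]] frechet_derivative_worksI[OF dg[OF that]]
    by (rule has_derivative_compose)
  have "Ck_on m S (\<lambda>x. frechet_derivative (\<lambda>x. g (f x)) (at x) v)" for v
  proof (subst Ck_on_cong[OF assms(1)])
    show "frechet_derivative (\<lambda>x. g (f x)) (at x) v =
        (\<Sum>b\<in>Basis. (frechet_derivative f (at x) v \<bullet> b) *\<^sub>R frechet_derivative g (at (f x)) b)"
      if "x \<in> S" for x
      using frechet_derivative_at[OF D[OF that]] frechet_derivative_apply_basis[OF dg[OF that]]
      by metis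
    show "Ck_on m S (\<lambda>x. \<Sum>b\<in>Basis.
        (frechet_derivative f (at x) v \<bullet> b) *\<^sub>R frechet_derivative g (at (f x)) b)"
      using Suc.prems Ck_on_Suc_imp[OF Suc.prems(1)]
      by (intro Ck_on_sum[OF assms(1)] bounded_bilinear.Ck_on_prod[OF bounded_bilinear_scaleR assms(1)]
          bounded_bilinear.Ck_on_prod[OF bounded_bilinear_inner assms(1)] Ck_on_const Suc.IH) auto
  qed
  then show ?case using D by (auto simp: differentiable_def)
qed

section \<open>Smooth maps\<close>

lemma smooth_on_cong: "open S \<Longrightarrow> (\<And>x. x \<in> S \<Longrightarrow> f x = g x) \<Longrightarrow> smooth_on S f \<longleftrightarrow> smooth_on S g"
  unfolding smooth_on_def using Ck_on_cong by blast

lemma smooth_on_subset: "smooth_on S f \<Longrightarrow> T \<subseteq> S \<Longrightarrow> smooth_on T f"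
  by (auto simp: smooth_on_def intro: Ck_on_subset)

lemma smooth_on_Un: "open S \<Longrightarrow> open T \<Longrightarrow> smooth_on S f \<Longrightarrow> smooth_on T f \<Longrightarrow> smooth_on (S \<union> T) f"
  using Ck_on_Union[of "{S, T}" _ f] by (auto simp: smooth_on_def)

lemma smooth_on_const: "smooth_on S (\<lambda>x. c)"
  by (simp add: smooth_on_def Ck_on_const)

lemma smooth_on_bounded_linear: "bounded_linear f \<Longrightarrow> smooth_on S f"
  by (simp add: smooth_on_def Ck_on_bounded_linear)

lemma smooth_on_add:
  "open S \<Longrightarrow> smooth_on S f \<Longrightarrow> smooth_on S g \<Longrightarrow> smooth_on S (\<lambda>x. f x + g x)"
  by (simp add: smooth_on_def Ck_on_add)

lemma smooth_on_sum:
  "open S \<Longrightarrow> (\<And>b. b \<in> B \<Longrightarrow> smooth_on S (f b)) \<Longrightarrow> smooth_on S (\<lambda>x. \<Sum>b\<in>B. f b x)"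
  by (simp add: smooth_on_def Ck_on_sum)

lemma (in bounded_bilinear) smooth_on_prod:
  "open S \<Longrightarrow> smooth_on S f \<Longrightarrow> smooth_on S g \<Longrightarrow> smooth_on S (\<lambda>x. prod (f x) (g x))"
  by (simp add: smooth_on_def Ck_on_prod)

lemmas smooth_on_scaleR = bounded_bilinear.smooth_on_prod[OF bounded_bilinear_scaleR]
lemmas smooth_on_inner = bounded_bilinear.smooth_on_prod[OF bounded_bilinear_inner]

lemma smooth_on_compose:
  fixes f :: "'a::real_normed_vector \<Rightarrow> 'b::euclidean_space"
  shows "open S \<Longrightarrow> f ` S \<subseteq> T \<Longrightarrow> smooth_on S f \<Longrightarrow> smooth_on T g \<Longrightarrow> smooth_on S (\<lambda>x. g (f x))"
  unfolding smooth_on_def by (intro allI Ck_on_compose[where f = f and g = g and T = T]) auto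

lemma smooth_on_imp_differentiable: "smooth_on S f \<Longrightarrow> x \<in> S \<Longrightarrow> f differentiable (at x)"
  unfolding smooth_on_def by (drule spec[of _ "Suc 0"]) simp

lemma smooth_on_frechet_derivative: "smooth_on S f \<Longrightarrow> smooth_on S (\<lambda>x. frechet_derivative f (at x) v)"
  unfolding smooth_on_def
proof
  fix m assume "\<forall>m. Ck_on m S f"
  then have "Ck_on (Suc m) S f" by blast
  then show "Ck_on m S (\<lambda>x. frechet_derivative f (at x) v)" by simp
qed

section \<open>Derivatives in a varying direction\<close>

lemma smooth_on_frechet_derivative_apply:
  fixes f :: "'a::euclidean_space \<Rightarrow> 'b::real_normed_vector"
  assumes "open S" "smooth_on S f" "smooth_on S h"
  shows "smooth_on S (\<lambda>x. frechet_derivative f (at x) (h x))"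
proof (subst smooth_on_cong[OF assms(1)])
  show "frechet_derivative f (at x) (h x) =
      (\<Sum>b\<in>Basis. (h x \<bullet> b) *\<^sub>R frechet_derivative f (at x) b)" if "x \<in> S" for x
    using assms that by (intro frechet_derivative_apply_basis smooth_on_imp_differentiable)
  show "smooth_on S (\<lambda>x. \<Sum>b\<in>Basis. (h x \<bullet> b) *\<^sub>R frechet_derivative f (at x) b)"
    using assms by (intro smooth_on_sum smooth_on_scaleR smooth_on_inner smooth_on_const
        smooth_on_frechet_derivative)
qed

text \<open>Product rule for the pairing of the derivative of \<open>f\<close> at \<open>g y\<close>
  with the vector \<open>h y\<close>: the second derivative of \<open>f\<close> appears when the
  base point moves, the first when the vector moves. It drives both the Jacobian of the bundle
  charts and the computation with vertical lifts.\<close>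

lemma has_derivative_frechet_derivative_apply:
  fixes f :: "'a::euclidean_space \<Rightarrow> 'b::real_normed_vector"
    and g :: "'c::real_normed_vector \<Rightarrow> 'a"
  assumes f: "open S" "smooth_on S f"
    and g: "(g has_derivative g') (at x)" "g x \<in> S"
    and h: "(h has_derivative h') (at x)"
  shows "((\<lambda>y. frechet_derivative f (at (g y)) (h y)) has_derivative
    (\<lambda>d. frechet_derivative (\<lambda>y. frechet_derivative f (at y) (h x)) (at (g x)) (g' d)
      + frechet_derivative f (at (g x)) (h' d))) (at x)"
proof -
  let ?D = "\<lambda>y v. frechet_derivative f (at y) v"
  let ?D2 = "\<lambda>v. frechet_derivative (\<lambda>y. ?D y v) (at (g x))"
  have diff: "f differentiable (at y)" if "y \<in> S" for y
    using f(2) that by (rule smooth_on_imp_differentiable)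
  have D2: "((\<lambda>y. ?D y v) has_derivative ?D2 v) (at (g x))" for v
    using smooth_on_imp_differentiable[OF smooth_on_frechet_derivative[OF f(2)] g(2)]
    by (rule frechet_derivative_worksI)
  have D2g: "((\<lambda>y. ?D (g y) v) has_derivative (\<lambda>d. ?D2 v (g' d))) (at x)" for v
    using g(1) D2 by (rule has_derivative_compose)
  have *: "((\<lambda>y. \<Sum>b\<in>Basis. (h y \<bullet> b) *\<^sub>R ?D (g y) b) has_derivative
      (\<lambda>d. \<Sum>b\<in>Basis. (h x \<bullet> b) *\<^sub>R ?D2 b (g' d) + (h' d \<bullet> b) *\<^sub>R ?D (g x) b)) (at x)"
    by (intro has_derivative_sum has_derivative_scaleR has_derivative_inner_left h D2g)
  have cont: "isCont g x" using g(1) has_derivative_continuous by blast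
  obtain T where T: "open T" "x \<in> T" "\<And>y. y \<in> T \<Longrightarrow> g y \<in> S"
    using continuous_at_open[of x g] cont f(1) g(2) by metis
  \<comment> \<open>The vector \<open>h x\<close> is constant here, so the basis expansion of the
    derivative of \<open>f\<close> may be differentiated term by term.\<close>
  have D2h: "?D2 (h x) d = (\<Sum>b\<in>Basis. (h x \<bullet> b) *\<^sub>R ?D2 b d)" for d
  proof -
    have "?D2 (h x) = frechet_derivative (\<lambda>y. \<Sum>b\<in>Basis. (h x \<bullet> b) *\<^sub>R ?D y b) (at (g x))"
      using f(1) g(2) by (rule frechet_derivative_cong_open)
        (rule frechet_derivative_apply_basis[OF diff])
    moreover have "((\<lambda>y. \<Sum>b\<in>Basis. (h x \<bullet> b) *\<^sub>R ?D y b) has_derivative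
        (\<lambda>d. \<Sum>b\<in>Basis. (h x \<bullet> b) *\<^sub>R ?D2 b d)) (at (g x))"
      by (intro has_derivative_sum has_derivative_scaleR_right D2)
    ultimately show ?thesis by (simp flip: frechet_derivative_at)
  qed
  have "((\<lambda>y. \<Sum>b\<in>Basis. (h y \<bullet> b) *\<^sub>R ?D (g y) b) has_derivative
      (\<lambda>d. ?D2 (h x) (g' d) + ?D (g x) (h' d))) (at x)"
    using * by (simp add: D2h sum.distrib flip: frechet_derivative_apply_basis[OF diff[OF g(2)]])
  then show ?thesis
    by (rule has_derivative_transform_within_open[OF _ T(1,2)])
      (rule frechet_derivative_apply_basis[symmetric, OF diff[OF T(3)]])
qed

lemma bounded_linear_axis: "bounded_linear (axis i :: 'a::euclidean_space \<Rightarrow> 'a^'k)"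
  by (intro linear_conv_bounded_linear[THEN iffD1] linearI) (auto simp: axis_def vec_eq_iff)

lemma sum_axis: "(\<Sum>i\<in>UNIV. axis i (c i)) = (\<chi> i. c i)" for c :: "'k::finite \<Rightarrow> 'a::euclidean_space"
  by (simp add: vec_eq_iff axis_def sum.delta if_distrib[of "\<lambda>v. v $ _"] cong: if_cong)

text \<open>A vector is the sum of its images under the bounded linear injections
  \<open>axis i\<close>, so the rule for finite sums applies.\<close>

lemma has_derivative_vec_lambda:
  fixes f :: "'k::finite \<Rightarrow> 'a::real_normed_vector \<Rightarrow> 'b::euclidean_space"
  assumes "\<And>i. (f i has_derivative f' i) (at x)"
  shows "((\<lambda>y. \<chi> i. f i y) has_derivative (\<lambda>d. \<chi> i. f' i d)) (at x)"
proof -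
  have "((\<lambda>y. \<Sum>i\<in>UNIV. axis i (f i y)) has_derivative (\<lambda>d. \<Sum>i\<in>UNIV. axis i (f' i d))) (at x)"
    by (intro has_derivative_sum bounded_linear.has_derivative[OF bounded_linear_axis] assms)
  then show ?thesis by (simp add: sum_axis)
qed

subsection \<open>Bump functions\<close>

text \<open>
  The functions \<open>p (1/t) exp (-1/t)\<close>, extended by zero, form a family closed under
  differentiation, as \<open>d/dt (p (1/t) exp (-1/t)) = (1/t)\<^sup>2 (p - p') (1/t) exp (-1/t)\<close>.
\<close>

definition flat_fun :: "real poly \<Rightarrow> real \<Rightarrow> real" where
  "flat_fun p t = (if t > 0 then poly p (inverse t) * exp (- inverse t) else 0)"


lemma DERIV_flat_fun:
  "(flat_fun p has_real_derivative flat_fun ([:0, 0, 1:] * (p - pderiv p)) t) (at t)"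
proof -
  consider "t > 0" | "t < 0" | "t = 0" by linarith
  then show ?thesis
  proof cases
    case 1
    have "((\<lambda>t. poly p (inverse t) * exp (- inverse t)) has_real_derivative
        flat_fun ([:0, 0, 1:] * (p - pderiv p)) t) (at t)"
      using 1 by (auto intro!: derivative_eq_intros DERIV_chain2[OF poly_DERIV]
          simp: flat_fun_def field_simps power2_eq_square)
    then show ?thesis
      by (rule DERIV_cong_ev[THEN iffD1, rotated -1])
        (use 1 in \<open>auto simp: flat_fun_def intro!: eventually_mono[OF eventually_gt_at_top]
          eventually_mono[OF order_tendstoD(1)[OF tendsto_ident_at]]
          eventually_nhds_in_open[of "{0<..}", THEN eventually_mono]\<close>)
  next
    case 2
    have "((\<lambda>t. 0) has_real_derivative flat_fun ([:0, 0, 1:] * (p - pderiv p)) t) (at t)"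
      using 2 by (simp add: flat_fun_def)
    then show ?thesis
      by (rule DERIV_cong_ev[THEN iffD1, rotated -1])
        (use 2 in \<open>auto simp: flat_fun_def intro!: eventually_nhds_in_open[of "{..<0}", THEN eventually_mono]\<close>)
  next
    case 3
    \<comment> \<open>Exponential decay beats every monomial, hence every polynomial.\<close>
    have lim: "((\<lambda>y. poly q y * exp (- y)) \<longlongrightarrow> 0) at_top" for q :: "real poly"
    proof -
      have "((\<lambda>y. \<Sum>i\<le>degree q. coeff q i * (y ^ i / exp y)) \<longlongrightarrow> (\<Sum>i\<le>degree q. coeff q i * 0)) at_top"
        by (intro tendsto_sum tendsto_mult tendsto_const tendsto_power_div_exp_0)
      then show ?thesis by (simp add: poly_altdef sum_distrib_right exp_minus divide_inverse mult.assoc)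
    qed
    \<comment> \<open>\<open>pCons 0 p\<close> is \<open>p\<close> times the variable; at
      \<open>inverse h\<close> this supplies the factor 1/h of the difference quotient.\<close>
    have "((\<lambda>h. poly (pCons 0 p) (inverse h) * exp (- inverse h)) \<longlongrightarrow> 0) (at_right 0)"
      by (rule filterlim_compose[OF lim filterlim_inverse_at_top_right])
    then have right: "((\<lambda>h. flat_fun p h / h) \<longlongrightarrow> 0) (at_right 0)"
      by (rule tendsto_cong[THEN iffD1, rotated])
        (auto simp: eventually_at_filter flat_fun_def divide_inverse mult.commute mult.left_commute)
    have "((\<lambda>h. flat_fun p h / h) \<longlongrightarrow> 0) (at_left 0)"
      by (rule tendsto_eventually) (auto simp: eventually_at_filter flat_fun_def)
    with right have "((\<lambda>h. flat_fun p h / h) \<longlongrightarrow> 0) (at 0)"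
      by (simp add: filterlim_at_split)
    then show ?thesis
      using 3 by (simp add: DERIV_def flat_fun_def)
  qed
qed

text \<open>The induction runs over all \<open>p\<close> at once: the derivative in direction
  \<open>v\<close> is again of this form, the scalar \<open>v\<close> being absorbed into the
  polynomial.\<close>

lemma smooth_on_flat_fun: "smooth_on UNIV (flat_fun p)"
proof -
  have "Ck_on m UNIV (flat_fun p)" for m
  proof (induction m arbitrary: p)
    case 0
    then show ?case using DERIV_flat_fun DERIV_continuous_on by (metis Ck_on.simps(1))
  next
    case (Suc m)
    define q where "q = [:0, 0, 1:] * (p - pderiv p)"
    have D: "(flat_fun p has_derivative (\<lambda>v. v * flat_fun q t)) (at t)" for t
      using DERIV_flat_fun[of p t] by (simp add: has_field_derivative_def q_def mult_commute_abs)
    then have "frechet_derivative (flat_fun p) (at t) v = flat_fun (smult v q) t" for t v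
      using frechet_derivative_at[OF D] by (metis flat_fun_def mult.assoc mult_zero_right poly_smult)
    then show ?case using D Suc.IH by (auto simp: differentiable_def)
  qed
  then show ?thesis by (simp add: smooth_on_def)
qed

lemma smooth_bump:
  fixes x0 :: "'a::euclidean_space"
  assumes "r > 0"
  obtains h :: "'a \<Rightarrow> real" where "smooth_on UNIV h" "h x0 = 1" "\<And>x. x \<notin> cball x0 r \<Longrightarrow> h x = 0"
proof
  \<comment> \<open>The argument is \<open>r\<^sup>2\<close> minus the squared distance to
    \<open>x0\<close>, written as an inner product to show smoothness; it is not positive outside
    the ball. The constant polynomial normalises the value at \<open>x0\<close> to 1.\<close>
  let ?f = "\<lambda>x. flat_fun [:exp (inverse (r\<^sup>2)):] (r\<^sup>2 + (x - x0) \<bullet> (x0 - x))"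
  have "smooth_on UNIV (\<lambda>x. - x0 + x)" "smooth_on UNIV (\<lambda>x. x0 + - x)"
    by (intro smooth_on_add smooth_on_const smooth_on_bounded_linear bounded_linear_minus
        bounded_linear_ident open_UNIV)+
  then have lin: "smooth_on UNIV (\<lambda>x. x - x0)" "smooth_on UNIV (\<lambda>x. x0 - x)"
    by simp_all
  show "smooth_on UNIV ?f"
    by (intro smooth_on_compose[OF _ _ _ smooth_on_flat_fun] smooth_on_add smooth_on_inner lin
        smooth_on_const) auto
  show "?f x0 = 1"
    using assms by (simp add: flat_fun_def flip: exp_add)
  show "?f x = 0" if "x \<notin> cball x0 r" for x
  proof -
    have "r\<^sup>2 \<le> (norm (x - x0))\<^sup>2"
      using that assms by (intro power_mono) (auto simp: dist_norm norm_minus_commute)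
    moreover have "(x - x0) \<bullet> (x0 - x) = - (norm (x - x0))\<^sup>2"
      by (simp add: power2_norm_eq_inner inner_diff inner_commute)
    ultimately show ?thesis by (simp add: flat_fun_def)
  qed
qed

section \<open>Tangent vectors in charts\<close>

text \<open>This first-order part of a manifold structure carries the calculus of tangent vectors.
  It is instantiated twice, for the base manifold and for the induced atlas of the bundle.\<close>

locale differentiable_atlas =
  fixes M :: "('m, 'i, 'e::euclidean_space) atlas"
  assumes inj_chart_map: "inj_on (chart_map M i) (chart_dom M i)"
    and open_overlap: "open (chart_map M i ` (chart_dom M i \<inter> chart_dom M j))"
    and transition_differentiable: "p \<in> chart_dom M i \<Longrightarrow> p \<in> chart_dom M j \<Longrightarrow>
      transition M i j differentiable (at (chart_map M i p))"
begin

lemma open_chart_image: "open (chart_map M i ` chart_dom M i)"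
  using open_overlap[of i i] by simp

lemma chart_inv_chart_map [simp]: "p \<in> chart_dom M i \<Longrightarrow> chart_inv M i (chart_map M i p) = p"
  by (simp add: chart_inv_def inj_chart_map)

lemma transition_chart_map [simp]:
  "p \<in> chart_dom M i \<Longrightarrow> transition M i j (chart_map M i p) = chart_map M j p"
  by (simp add: transition_def)

text \<open>Chain rule on the overlap, where the expression of \<open>F\<close> in chart
  \<open>i\<close> is its expression in chart \<open>j\<close> after the transition map. With a
  chart map as \<open>F\<close> it is the cocycle identity of Jacobians.\<close>

lemma frechet_derivative_change_chart:
  assumes p: "p \<in> chart_dom M i" "p \<in> chart_dom M j"
    and F: "(\<lambda>x. F (chart_inv M j x)) differentiable (at (chart_map M j p))"
  shows "frechet_derivative (\<lambda>x. F (chart_inv M i x)) (at (chart_map M i p)) e =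
    frechet_derivative (\<lambda>x. F (chart_inv M j x)) (at (chart_map M j p))
      (frechet_derivative (transition M i j) (at (chart_map M i p)) e)"
proof -
  let ?x = "chart_map M i p"
  have "((\<lambda>x. F (chart_inv M j (transition M i j x))) has_derivative
      (\<lambda>e. frechet_derivative (\<lambda>x. F (chart_inv M j x)) (at (transition M i j ?x))
        (frechet_derivative (transition M i j) (at ?x) e))) (at ?x)"
    by (rule has_derivative_compose[OF frechet_derivative_worksI frechet_derivative_worksI])
      (use p F in \<open>simp_all add: transition_differentiable\<close>)
  then have "((\<lambda>x. F (chart_inv M i x)) has_derivative
      (\<lambda>e. frechet_derivative (\<lambda>x. F (chart_inv M j x)) (at (transition M i j ?x))
        (frechet_derivative (transition M i j) (at ?x) e))) (at ?x)"
    by (rule has_derivative_transform_within_open[OF _ open_overlap[of i j]]) (use p in auto)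
  then show ?thesis
    using p by (simp flip: frechet_derivative_at)
qed

lemma frechet_derivative_transition_self:
  assumes "p \<in> chart_dom M i"
  shows "frechet_derivative (transition M i i) (at (chart_map M i p)) e = e"
proof -
  have "frechet_derivative (transition M i i) (at (chart_map M i p)) =
      frechet_derivative (\<lambda>x. x) (at (chart_map M i p))"
    by (rule frechet_derivative_cong_open[OF open_chart_image[of i]]) (use assms in auto)
  then show ?thesis by simp
qed

lemma tangent_space_change_chart:
  "v \<in> tangent_space M p \<Longrightarrow> p \<in> chart_dom M i \<Longrightarrow> p \<in> chart_dom M j \<Longrightarrow>
    v j = frechet_derivative (transition M i j) (at (chart_map M i p)) (v i)"
  unfolding tangent_space_def by blast

lemma tangent_space_outside: "v \<in> tangent_space M p \<Longrightarrow> p \<notin> chart_dom M j \<Longrightarrow> v j = 0"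
  unfolding tangent_space_def by blast

text \<open>One component fixes those in all charts around \<open>p\<close> through the Jacobians;
  the other components are zero by convention.\<close>

lemma tangent_space_eqI:
  "v \<in> tangent_space M p \<Longrightarrow> v' \<in> tangent_space M p \<Longrightarrow> p \<in> chart_dom M i \<Longrightarrow> v i = v' i \<Longrightarrow> v = v'"
  by (rule ext) (metis tangent_space_change_chart tangent_space_outside)

lemma tangent_of_self [simp]: "p \<in> chart_dom M i \<Longrightarrow> tangent_of M i p e i = e"
  by (simp add: tangent_of_def frechet_derivative_transition_self)

lemma tangent_of_in_tangent_space:
  assumes "p \<in> chart_dom M i"
  shows "tangent_of M i p e \<in> tangent_space M p"
proof -
  \<comment> \<open>Cocycle identity: change of chart applied to the map
    \<open>chart_map M k\<close>.\<close>
  have *: "frechet_derivative (transition M i k) (at (chart_map M i p)) e =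
      frechet_derivative (transition M j k) (at (chart_map M j p))
        (frechet_derivative (transition M i j) (at (chart_map M i p)) e)"
    if "p \<in> chart_dom M j" "p \<in> chart_dom M k" for j k
    using frechet_derivative_change_chart[OF assms that(1), of "chart_map M k"]
      transition_differentiable[OF that]
    by (simp add: transition_def[abs_def])
  show ?thesis
    unfolding tangent_space_def tangent_of_def by (auto intro: *)
qed

lemma tangent_of_component:
  "v \<in> tangent_space M p \<Longrightarrow> p \<in> chart_dom M i \<Longrightarrow> tangent_of M i p (v i) = v"
  by (rule tangent_space_eqI) (auto intro: tangent_of_in_tangent_space)

lemma zero_in_tangent_space: "(\<lambda>i. 0) \<in> tangent_space M p"
proof -
  have "frechet_derivative (transition M i j) (at (chart_map M i p)) 0 = 0"
    if "p \<in> chart_dom M i" "p \<in> chart_dom M j" for i j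
    by (rule linear_0[OF linear_frechet_derivative[OF transition_differentiable[OF that]]])
  then show ?thesis by (auto simp: tangent_space_def)
qed

lemma chart_at_in: "p \<in> points M \<Longrightarrow> p \<in> chart_dom M (chart_at M p)"
  unfolding chart_at_def points_def by (rule someI_ex) auto

lemma smooth_function_differentiable:
  "smooth_function M f \<Longrightarrow> p \<in> chart_dom M i \<Longrightarrow>
    (\<lambda>x. f (chart_inv M i x)) differentiable (at (chart_map M i p))"
  unfolding smooth_function_def using smooth_on_imp_differentiable by blast

text \<open>Independence of the chart picked by \<open>chart_at\<close>: the Jacobian from the chain
  rule is the one that transforms the components of \<open>v\<close>.\<close>

lemma differential_in_chart:
  assumes "smooth_function M f" "v \<in> tangent_space M p" "p \<in> chart_dom M i"
  shows "differential M f p v =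
    frechet_derivative (\<lambda>x. f (chart_inv M i x)) (at (chart_map M i p)) (v i)"
proof -
  have p: "p \<in> chart_dom M (chart_at M p)"
    using assms(3) by (intro chart_at_in) (auto simp: points_def)
  show ?thesis
    using frechet_derivative_change_chart[OF p assms(3) smooth_function_differentiable[OF assms(1,3)]]
      tangent_space_change_chart[OF assms(2) p assms(3)]
    by (simp add: differential_def Let_def)
qed

text \<open>Induction over the generation of the topology. Intersections use injectivity of the
  chart; a generating set from chart \<open>j\<close> becomes a preimage under the continuous
  transition map.\<close>

lemma open_chart_image_openin:
  assumes "openin (atlas_topology M) W"
  shows "open (chart_map M i ` (chart_dom M i \<inter> W))"
proof -
  have "generate_topology_on {{p \<in> chart_dom M i. chart_map M i p \<in> V} | i V. open V} W"
    using assms by (simp add: atlas_topology_def openin_topology_generated_by_iff)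
  then show ?thesis
  proof induction
    case Empty
    then show ?case by simp
  next
    case (Int a b)
    have "chart_map M i ` (chart_dom M i \<inter> (a \<inter> b)) =
        chart_map M i ` (chart_dom M i \<inter> a) \<inter> chart_map M i ` (chart_dom M i \<inter> b)"
      using inj_on_image_Int[OF inj_chart_map, of "chart_dom M i \<inter> a" i "chart_dom M i \<inter> b"]
      by (simp add: Int_ac)
    then show ?case using Int by auto
  next
    case (UN K)
    have "chart_map M i ` (chart_dom M i \<inter> \<Union>K) = (\<Union>k\<in>K. chart_map M i ` (chart_dom M i \<inter> k))"
      by auto
    then show ?case using UN by auto
  next
    case (Basis s)
    then obtain j V where s: "s = {p \<in> chart_dom M j. chart_map M j p \<in> V}" "open V" by blast
    have "continuous_on (chart_map M i ` (chart_dom M i \<inter> chart_dom M j)) (transition M i j)"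
      using transition_differentiable
      by (auto intro!: continuous_at_imp_continuous_on differentiable_imp_continuous_within)
    then have "open (transition M i j -` V \<inter> chart_map M i ` (chart_dom M i \<inter> chart_dom M j))"
      using s(2) open_overlap continuous_on_open_vimage by blast
    moreover have "transition M i j -` V \<inter> chart_map M i ` (chart_dom M i \<inter> chart_dom M j) =
        chart_map M i ` (chart_dom M i \<inter> s)"
      using s(1) by auto
    ultimately show ?case by simp
  qed
qed

end

section \<open>Topology and vector fields of a smooth manifold\<close>

lemma smooth_manifold_imp_differentiable_atlas: "smooth_manifold M \<Longrightarrow> differentiable_atlas M"
  unfolding smooth_manifold_def
  by unfold_locales (blast intro: smooth_on_imp_differentiable)+

lemma openin_chart_dom: "openin (atlas_topology M) (chart_dom M i)"
  unfolding atlas_topology_def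
  by (rule topology_generated_by_Basis) (auto intro!: exI[of _ i] exI[of _ UNIV])

lemma openin_points: "openin (atlas_topology M) (points M)"
  unfolding points_def by (intro openin_Union ballI) (auto intro: openin_chart_dom)

lemma topspace_atlas_topology: "topspace (atlas_topology M) = points M"
proof
  show "topspace (atlas_topology M) \<subseteq> points M"
    by (auto simp: atlas_topology_def points_def)
  show "points M \<subseteq> topspace (atlas_topology M)"
    by (rule openin_subset[OF openin_points])
qed

text \<open>Seen from chart \<open>j\<close>, the field is the Jacobian of the transition from
  \<open>i\<close> to \<open>j\<close> applied to \<open>h\<close>, evaluated after the transition
  from \<open>j\<close> to \<open>i\<close>; all of these are smooth.\<close>

lemma vector_field_on_tangent_of:
  assumes M: "smooth_manifold M" and h: "smooth_on (chart_map M i ` chart_dom M i) h"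
  shows "vector_field_on M (chart_dom M i) (\<lambda>p. tangent_of M i p (h (chart_map M i p)))"
proof -
  interpret differentiable_atlas M using M by (rule smooth_manifold_imp_differentiable_atlas)
  have trans: "smooth_on (chart_map M i ` (chart_dom M i \<inter> chart_dom M j)) (transition M i j)" for i j
    using M by (auto simp: smooth_manifold_def)
  have "smooth_on (chart_map M j ` (chart_dom M j \<inter> chart_dom M i))
      (\<lambda>x. tangent_of M i (chart_inv M j x) (h (chart_map M i (chart_inv M j x))) j)" for j
  proof (subst smooth_on_cong[OF open_overlap])
    let ?f = "\<lambda>y. frechet_derivative (transition M i j) (at y) (h y)"
    show "tangent_of M i (chart_inv M j x) (h (chart_map M i (chart_inv M j x))) j =
        ?f (transition M j i x)"
      if "x \<in> chart_map M j ` (chart_dom M j \<inter> chart_dom M i)" for x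
      using that by (auto simp: tangent_of_def)
    show "smooth_on (chart_map M j ` (chart_dom M j \<inter> chart_dom M i)) (\<lambda>x. ?f (transition M j i x))"
      by (rule smooth_on_compose[where T = "chart_map M i ` (chart_dom M i \<inter> chart_dom M j)"
            and g = ?f and f = "transition M j i"])
        (auto intro!: open_overlap trans smooth_on_frechet_derivative_apply
            intro: smooth_on_subset[OF h])
  qed
  then show ?thesis
    by (auto simp: vector_field_on_def openin_chart_dom tangent_of_in_tangent_space)
qed

text \<open>The set is the image of \<open>K\<close> under \<open>chart_inv M i\<close>, which is
  continuous because chart images of open sets are open. It is thus compact, and closed since the
  manifold is Hausdorff.\<close>

lemma closedin_preimage_compact:
  assumes M: "smooth_manifold M" and K: "compact K" "K \<subseteq> chart_map M i ` chart_dom M i"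
  shows "closedin (atlas_topology M) {p \<in> chart_dom M i. chart_map M i p \<in> K}"
proof -
  interpret differentiable_atlas M using M by (rule smooth_manifold_imp_differentiable_atlas)
  let ?U = "chart_map M i ` chart_dom M i"
  have "{x \<in> ?U. chart_inv M i x \<in> W} = chart_map M i ` (chart_dom M i \<inter> W)" for W
    by auto
  then have "continuous_map (top_of_set ?U) (atlas_topology M) (chart_inv M i)"
    using open_chart_image_openin[of _ i] open_chart_image[of i]
    by (auto simp: continuous_map_def topspace_atlas_topology points_def openin_open_eq)
  then have "compactin (atlas_topology M) (chart_inv M i ` K)"
    using K by (intro image_compactin[where X = "top_of_set ?U"]) (auto simp: compactin_subtopology)
  then have "closedin (atlas_topology M) (chart_inv M i ` K)"
    using M by (intro compactin_imp_closedin) (auto simp: smooth_manifold_def)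
  moreover have "chart_inv M i ` K = {p \<in> chart_dom M i. chart_map M i p \<in> K}"
  proof
    show "chart_inv M i ` K \<subseteq> {p \<in> chart_dom M i. chart_map M i p \<in> K}"
      using K(2) by auto
    show "{p \<in> chart_dom M i. chart_map M i p \<in> K} \<subseteq> chart_inv M i ` K"
      using chart_inv_chart_map by (auto intro!: rev_image_eqI)
  qed
  ultimately show ?thesis by simp
qed

text \<open>The field with constant components \<open>e\<close> in chart \<open>i\<close> is
  multiplied by a bump function supported in a closed ball inside the chart image, and extended by
  zero.\<close>

lemma exists_vector_field_with_value:
  assumes M: "smooth_manifold M" and p: "p \<in> chart_dom M i"
  obtains X where "vector_field_on M (points M) X" "X p i = e"
proof -
  interpret differentiable_atlas M using M by (rule smooth_manifold_imp_differentiable_atlas)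
  obtain r where r: "r > 0" "cball (chart_map M i p) r \<subseteq> chart_map M i ` chart_dom M i"
    using open_chart_image p open_contains_cball by blast
  obtain h :: "_ \<Rightarrow> real" where h: "smooth_on UNIV h" "h (chart_map M i p) = 1"
      "\<And>x. x \<notin> cball (chart_map M i p) r \<Longrightarrow> h x = 0"
    using smooth_bump[OF r(1)] by blast
  define X where "X q = (if q \<in> chart_dom M i
      then tangent_of M i q (h (chart_map M i q) *\<^sub>R e) else (\<lambda>i. 0))" for q
  define C where "C = {q \<in> chart_dom M i. chart_map M i q \<in> cball (chart_map M i p) r}"
  have C: "openin (atlas_topology M) (points M - C)"
    using closedin_preimage_compact[OF M compact_cball r(2)]
    by (simp add: C_def closedin_def topspace_atlas_topology)
  have vf: "vector_field_on M (chart_dom M i)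
      (\<lambda>q. tangent_of M i q (h (chart_map M i q) *\<^sub>R e))"
    using h(1) by (intro vector_field_on_tangent_of[OF M, where h = "\<lambda>x. h x *\<^sub>R e"]
        smooth_on_scaleR smooth_on_const open_chart_image) (auto intro: smooth_on_subset)
  have tangent: "X q \<in> tangent_space M q" for q
    by (auto simp: X_def tangent_of_in_tangent_space zero_in_tangent_space)
  have zero: "X q = (\<lambda>i. 0)" if "q \<notin> C" for q
  proof (cases "q \<in> chart_dom M i")
    case True
    then show ?thesis
      using that h(3) tangent[of q]
      by (intro tangent_space_eqI[OF _ zero_in_tangent_space True]) (auto simp: X_def C_def)
  qed (simp add: X_def)
  \<comment> \<open>Two open sets cover the manifold: the domain of chart \<open>i\<close>, where
    the formula is smooth, and the complement of the closed set \<open>C\<close>, where the field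
    vanishes.\<close>
  have "smooth_on (chart_map M j ` (chart_dom M j \<inter> points M)) (\<lambda>x. X (chart_inv M j x) j)" for j
  proof -
    let ?A = "chart_map M j ` (chart_dom M j \<inter> chart_dom M i)"
    let ?B = "chart_map M j ` (chart_dom M j \<inter> (points M - C))"
    have "smooth_on ?A (\<lambda>x. X (chart_inv M j x) j)"
      by (subst smooth_on_cong[OF open_overlap, where g =
            "\<lambda>x. tangent_of M i (chart_inv M j x) (h (chart_map M i (chart_inv M j x)) *\<^sub>R e) j"])
        (use vf in \<open>auto simp: X_def vector_field_on_def\<close>)
    moreover have "smooth_on ?B (\<lambda>x. X (chart_inv M j x) j)"
      by (subst smooth_on_cong[OF open_chart_image_openin[OF C], where g = "\<lambda>x. 0"])
        (auto simp: zero smooth_on_const)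
    ultimately have "smooth_on (?A \<union> ?B) (\<lambda>x. X (chart_inv M j x) j)"
      by (intro smooth_on_Un open_overlap open_chart_image_openin[OF C])
    then show ?thesis
      by (rule smooth_on_subset) (auto simp: C_def points_def)
  qed
  then have "vector_field_on M (points M) X"
    by (simp add: vector_field_on_def openin_points tangent)
  moreover have "X p i = e"
    using p h(2) by (simp add: X_def)
  ultimately show ?thesis by (rule that)
qed

lemma local_frame_coordinate:
  fixes M :: "('m, 'i, real^'n) atlas"
  assumes M: "smooth_manifold M"
  shows "local_frame M (chart_dom M i) (\<lambda>A p. tangent_of M i p (axis A 1))"
  unfolding local_frame_def
proof (intro conjI allI ballI)
  interpret differentiable_atlas M using M by (rule smooth_manifold_imp_differentiable_atlas)
  show "vector_field_on M (chart_dom M i) (\<lambda>p. tangent_of M i p (axis A 1))" for A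
    by (rule vector_field_on_tangent_of[OF M smooth_on_const])
  fix p v assume p: "p \<in> chart_dom M i" and v: "v \<in> tangent_space M p"
  have lin: "linear (frechet_derivative (transition M i j) (at (chart_map M i p)))"
    if "p \<in> chart_dom M j" for j
    using transition_differentiable[OF p that] by (rule linear_frechet_derivative)
  \<comment> \<open>Combining the coordinate fields with coefficients \<open>c\<close> gives the
    tangent vector with components \<open>c\<close> in chart \<open>i\<close>; existence and
    uniqueness of the coefficients can then be read off in that chart.\<close>
  have sum: "(\<lambda>j. \<Sum>A\<in>UNIV. c A *\<^sub>R tangent_of M i p (axis A 1) j) = tangent_of M i p (\<chi> A. c A)"
    for c
  proof
    show "(\<Sum>A\<in>UNIV. c A *\<^sub>R tangent_of M i p (axis A 1) j) = tangent_of M i p (\<chi> A. c A) j" for j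
    proof (cases "p \<in> chart_dom M j")
      case True
      have "(\<chi> A. c A) = (\<Sum>A\<in>UNIV. c A *\<^sub>R (axis A 1 :: real^'n))"
        using basis_expansion[of "\<chi> A. c A"] by (simp add: scalar_mult_eq_scaleR)
      then show ?thesis
        using True by (simp add: tangent_of_def linear_sum[OF lin] linear_cmul[OF lin])
    qed (simp add: tangent_of_def)
  qed
  show "\<exists>!c. v = (\<lambda>j. \<Sum>A\<in>UNIV. c A *\<^sub>R tangent_of M i p (axis A 1) j)"
    unfolding sum
  proof (rule ex1I)
    show "v = tangent_of M i p (\<chi> A. v i $ A)"
      using tangent_of_component[OF v p] by simp
    show "c = ($) (v i)" if "v = tangent_of M i p (\<chi> A. c A)" for c
      using that p by (simp add: fun_eq_iff)
  qed
qed

section \<open>The induced atlas of the bundle\<close>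

lemma chart_dom_T1k:
  "w \<in> chart_dom (T1k Q) i \<longleftrightarrow>
    fst w \<in> chart_dom Q i \<and> (\<forall>\<alpha>. snd w \<alpha> \<in> tangent_space Q (fst w))"
  by (auto simp: T1k_def)

lemma chart_map_T1k: "chart_map (T1k Q) i w = (chart_map Q i (fst w), \<chi> \<alpha>. snd w \<alpha> i)"
  by (simp add: T1k_def case_prod_beta)

lemma fst_chart_map_T1k: "fst (chart_map (T1k Q) i w) = chart_map Q i (fst w)"
  and snd_chart_map_T1k: "snd (chart_map (T1k Q) i w) $ \<alpha> = snd w \<alpha> i"
  by (simp_all add: chart_map_T1k)

text \<open>The \<open>itself\<close> parameter fixes the type \<open>'k\<close>, so that the bundle
  \<open>TQ\<close> has a definite type within the locale.\<close>

locale smooth_base =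
  fixes Q :: "('q, 'i, real^'n) atlas" and k_type :: "'k::finite itself"
  assumes smooth_manifold: "smooth_manifold Q"
begin

sublocale base: differentiable_atlas Q
  using smooth_manifold by (rule smooth_manifold_imp_differentiable_atlas)

abbreviation TQ :: "(('q, 'i, 'n, 'k) t1k, 'i, ('n, 'k) t1k_coords) atlas" where
  "TQ \<equiv> T1k Q"

lemma inj_on_chart_map_T1k: "inj_on (chart_map TQ i) (chart_dom TQ i)"
proof (rule inj_onI)
  fix w w' assume *: "w \<in> chart_dom TQ i" "w' \<in> chart_dom TQ i" "chart_map TQ i w = chart_map TQ i w'"
  then have "fst w = fst w'"
    using base.inj_chart_map by (auto simp: chart_dom_T1k chart_map_T1k dest: inj_onD)
  moreover have "snd w \<alpha> = snd w' \<alpha>" for \<alpha>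
    using * \<open>fst w = fst w'\<close>
    by (intro base.tangent_space_eqI[of _ "fst w" _ i]) (auto simp: chart_dom_T1k chart_map_T1k vec_eq_iff)
  ultimately show "w = w'" by (simp add: prod_eq_iff fun_eq_iff)
qed

lemma chart_inv_T1k:
  assumes "q \<in> chart_dom Q i"
  shows "chart_inv TQ i (chart_map Q i q, u) = (q, \<lambda>\<alpha>. tangent_of Q i q (u $ \<alpha>))"
  unfolding chart_inv_def
  by (rule inv_into_f_eq[OF inj_on_chart_map_T1k])
    (use assms in \<open>auto simp: chart_dom_T1k chart_map_T1k base.tangent_of_in_tangent_space\<close>)

lemma chart_image_T1k:
  "chart_map TQ i ` (chart_dom TQ i \<inter> chart_dom TQ j) =
    chart_map Q i ` (chart_dom Q i \<inter> chart_dom Q j) \<times> UNIV"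
proof
  show "chart_map TQ i ` (chart_dom TQ i \<inter> chart_dom TQ j) \<subseteq>
      chart_map Q i ` (chart_dom Q i \<inter> chart_dom Q j) \<times> UNIV"
    by (auto simp: chart_dom_T1k chart_map_T1k)
  have "(chart_map Q i q, u) \<in> chart_map TQ i ` (chart_dom TQ i \<inter> chart_dom TQ j)"
    if "q \<in> chart_dom Q i" "q \<in> chart_dom Q j" for q u
    using that
    by (intro image_eqI[of _ _ "(q, \<lambda>\<alpha>. tangent_of Q i q (u $ \<alpha>))"])
      (auto simp: chart_dom_T1k chart_map_T1k base.tangent_of_in_tangent_space)
  then show "chart_map Q i ` (chart_dom Q i \<inter> chart_dom Q j) \<times> UNIV \<subseteq>
      chart_map TQ i ` (chart_dom TQ i \<inter> chart_dom TQ j)"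
    by auto
qed

lemma transition_T1k:
  assumes "x \<in> chart_map Q i ` (chart_dom Q i \<inter> chart_dom Q j)"
  shows "transition TQ i j (x, u) =
    (transition Q i j x, \<chi> \<alpha>. frechet_derivative (transition Q i j) (at x) (u $ \<alpha>))"
  using assms by (auto simp: transition_def[of TQ] chart_inv_T1k chart_map_T1k tangent_of_def vec_eq_iff)

text \<open>The fibre part is the Jacobian of the base transition applied to each u_\<alpha>. The
  product rule therefore yields a second derivative of the transition in the base direction, and the
  Jacobian in the fibre directions.\<close>

lemma has_derivative_transition_T1k:
  assumes x: "x \<in> chart_map Q i ` (chart_dom Q i \<inter> chart_dom Q j)"
  shows "(transition TQ i j has_derivative
    (\<lambda>d. (frechet_derivative (transition Q i j) (at x) (fst d),
      \<chi> \<alpha>. frechet_derivative (\<lambda>y. frechet_derivative (transition Q i j) (at y) (u $ \<alpha>)) (at x) (fst d)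
        + frechet_derivative (transition Q i j) (at x) (snd d $ \<alpha>)))) (at (x, u))"
proof -
  let ?U = "chart_map Q i ` (chart_dom Q i \<inter> chart_dom Q j)"
  have smooth: "smooth_on ?U (transition Q i j)"
    using smooth_manifold by (auto simp: smooth_manifold_def)
  have fst: "(fst has_derivative fst) (at (x, u))"
    by (intro bounded_linear_imp_has_derivative bounded_linear_fst)
  have snd: "((\<lambda>y. snd y $ \<alpha>) has_derivative (\<lambda>d. snd d $ \<alpha>)) (at (x, u))" for \<alpha>
    by (intro bounded_linear_imp_has_derivative bounded_linear_compose[OF bounded_linear_vec_nth]
        bounded_linear_snd)
  have D1: "((\<lambda>y. transition Q i j (fst y)) has_derivative
      (\<lambda>d. frechet_derivative (transition Q i j) (at (fst (x, u))) (fst d))) (at (x, u))"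
    by (rule has_derivative_compose[OF fst frechet_derivative_worksI])
      (use x in \<open>auto intro: smooth_on_imp_differentiable[OF smooth]\<close>)
  have D2: "((\<lambda>y. frechet_derivative (transition Q i j) (at (fst y)) (snd y $ \<alpha>)) has_derivative
      (\<lambda>d. frechet_derivative (\<lambda>y. frechet_derivative (transition Q i j) (at y) (snd (x, u) $ \<alpha>))
          (at (fst (x, u))) (fst d)
        + frechet_derivative (transition Q i j) (at (fst (x, u))) (snd d $ \<alpha>))) (at (x, u))" for \<alpha>
    by (rule has_derivative_frechet_derivative_apply[OF base.open_overlap smooth fst _ snd])
      (use x in auto)
  have "((\<lambda>y. (transition Q i j (fst y),
        \<chi> \<alpha>. frechet_derivative (transition Q i j) (at (fst y)) (snd y $ \<alpha>))) has_derivative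
    (\<lambda>d. (frechet_derivative (transition Q i j) (at x) (fst d),
      \<chi> \<alpha>. frechet_derivative (\<lambda>y. frechet_derivative (transition Q i j) (at y) (u $ \<alpha>)) (at x) (fst d)
        + frechet_derivative (transition Q i j) (at x) (snd d $ \<alpha>)))) (at (x, u))"
    using has_derivative_Pair[OF D1 has_derivative_vec_lambda[OF D2]] by simp
  then show ?thesis
    by (rule has_derivative_transform_within_open[where s = "?U \<times> UNIV"])
      (use x in \<open>auto simp: transition_T1k open_Times base.open_overlap\<close>)
qed

text \<open>From here on the unqualified facts concern the bundle, and those about the base carry
  the prefix \<open>base\<close>.\<close>

sublocale differentiable_atlas TQ
proof
  show "inj_on (chart_map TQ i) (chart_dom TQ i)" for i
    by (rule inj_on_chart_map_T1k)
  show "open (chart_map TQ i ` (chart_dom TQ i \<inter> chart_dom TQ j))" for i j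
    by (simp add: chart_image_T1k open_Times base.open_overlap)
  show "transition TQ i j differentiable (at (chart_map TQ i p))"
    if "p \<in> chart_dom TQ i" "p \<in> chart_dom TQ j" for p i j
    unfolding chart_map_T1k
    by (rule differentiableI[OF has_derivative_transition_T1k]) (use that in \<open>auto simp: chart_dom_T1k\<close>)
qed

section \<open>Tangent vectors of the bundle in induced charts\<close>

lemma frechet_derivative_transition_T1k:
  assumes "w \<in> chart_dom TQ i" "w \<in> chart_dom TQ j"
  shows "frechet_derivative (transition TQ i j) (at (chart_map TQ i w)) d =
    (frechet_derivative (transition Q i j) (at (chart_map Q i (fst w))) (fst d),
      \<chi> \<alpha>. frechet_derivative (\<lambda>y. frechet_derivative (transition Q i j) (at y) (snd w \<alpha> i))
          (at (chart_map Q i (fst w))) (fst d)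
        + frechet_derivative (transition Q i j) (at (chart_map Q i (fst w))) (snd d $ \<alpha>))"
proof -
  have "chart_map Q i (fst w) \<in> chart_map Q i ` (chart_dom Q i \<inter> chart_dom Q j)"
    using assms by (auto simp: chart_dom_T1k)
  from fun_cong[OF frechet_derivative_at[OF has_derivative_transition_T1k[OF this,
        of "\<chi> \<alpha>. snd w \<alpha> i"]], of d] show ?thesis
    by (simp add: chart_map_T1k)
qed

text \<open>With zero base part the second-derivative term drops out, and each fibre component
  transforms like a tangent vector of \<open>Q\<close>.\<close>

lemma vertical_in_tangent_space:
  assumes w: "w \<in> points TQ" and z: "z \<in> tangent_space Q (fst w)"
  shows "(\<lambda>i. (0, axis \<alpha> (z i))) \<in> tangent_space TQ w"
proof -
  have lin: "linear (frechet_derivative (transition Q i j) (at (chart_map Q i (fst w))))"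
    and lin2: "linear (frechet_derivative (\<lambda>y. frechet_derivative (transition Q i j) (at y) u)
        (at (chart_map Q i (fst w))))"
    if "w \<in> chart_dom TQ i" "w \<in> chart_dom TQ j" for i j u
  proof -
    have "smooth_on (chart_map Q i ` (chart_dom Q i \<inter> chart_dom Q j)) (transition Q i j)"
      using smooth_manifold by (auto simp: smooth_manifold_def)
    moreover have "chart_map Q i (fst w) \<in> chart_map Q i ` (chart_dom Q i \<inter> chart_dom Q j)"
      using that by (auto simp: chart_dom_T1k)
    ultimately show "linear (frechet_derivative (transition Q i j) (at (chart_map Q i (fst w))))"
      and "linear (frechet_derivative (\<lambda>y. frechet_derivative (transition Q i j) (at y) u)
        (at (chart_map Q i (fst w))))"
      by (auto intro!: linear_frechet_derivative
          intro: smooth_on_imp_differentiable smooth_on_frechet_derivative)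
  qed
  have "(0, axis \<alpha> (z j)) =
      frechet_derivative (transition TQ i j) (at (chart_map TQ i w)) (0, axis \<alpha> (z i))"
    if w: "w \<in> chart_dom TQ i" "w \<in> chart_dom TQ j" for i j
  proof -
    have "z j = frechet_derivative (transition Q i j) (at (chart_map Q i (fst w))) (z i)"
      using z w by (intro base.tangent_space_change_chart) (auto simp: chart_dom_T1k)
    then show ?thesis
      by (simp add: frechet_derivative_transition_T1k[OF w] linear_0[OF lin[OF w]]
          linear_0[OF lin2[OF w]] axis_def vec_eq_iff)
  qed
  moreover have "(0, axis \<alpha> (z i)) = 0" if "w \<notin> chart_dom TQ i" for i
  proof -
    have "fst w \<notin> chart_dom Q i"
      using w that by (auto simp: points_def chart_dom_T1k)
    then show ?thesis
      using base.tangent_space_outside[OF z] by (simp add: axis_def zero_prod_def vec_eq_iff)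
  qed
  ultimately show ?thesis
    unfolding tangent_space_def by blast
qed


text \<open>The Jacobian of the bundle transition is block triangular, so base parts transform among
  themselves.\<close>

lemma fst_in_tangent_space:
  assumes w: "w \<in> points TQ" and v: "v \<in> tangent_space TQ w"
  shows "(\<lambda>i. fst (v i)) \<in> tangent_space Q (fst w)"
proof -
  have dom: "w \<in> chart_dom TQ i \<longleftrightarrow> fst w \<in> chart_dom Q i" for i
    using w by (auto simp: points_def chart_dom_T1k)
  have "fst (v j) = frechet_derivative (transition Q i j) (at (chart_map Q i (fst w))) (fst (v i))"
    if "w \<in> chart_dom TQ i" "w \<in> chart_dom TQ j" for i j
    by (subst tangent_space_change_chart[OF v that])
      (simp add: frechet_derivative_transition_T1k[OF that])
  moreover have "fst (v i) = 0" if "w \<notin> chart_dom TQ i" for i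
    using tangent_space_outside[OF v that] by simp
  ultimately show ?thesis
    unfolding tangent_space_def dom by blast
qed

text \<open>\<open>tangent_map\<close> is evaluated in the chart picked by \<open>chart_at\<close>;
  a change of chart carries it to chart \<open>i\<close>, where the projection reads
  \<open>fst\<close>. The base part of \<open>\<Gamma> \<alpha>\<close> is thus u_\<alpha> in every
  induced chart.\<close>

lemma SOPDE_fst:
  fixes \<Gamma> :: "'k \<Rightarrow> ('q, 'i, 'n, 'k) t1k \<Rightarrow> 'i \<Rightarrow> ('n, 'k) t1k_coords"
  assumes \<Gamma>: "SOPDE Q \<Gamma>" and w: "w \<in> chart_dom TQ i"
  shows "fst (\<Gamma> \<alpha> w i) = snd w \<alpha> i"
proof -
  have pts: "w \<in> points TQ" using w by (auto simp: points_def)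
  let ?j = "chart_at TQ w"
  let ?F = "\<lambda>w. chart_map Q i (fst w)"
  have j: "w \<in> chart_dom TQ ?j" using pts by (rule chart_at_in)
  have tangent: "\<Gamma> \<alpha> w \<in> tangent_space TQ w"
    using \<Gamma> pts by (auto simp: SOPDE_def vector_field_on_def)
  have "((\<lambda>x. ?F (chart_inv TQ i x)) has_derivative fst) (at (chart_map TQ i w))"
    by (rule has_derivative_transform_within_open[OF
          bounded_linear_imp_has_derivative[OF bounded_linear_fst] open_chart_image[of i]])
      (use w in \<open>auto simp: fst_chart_map_T1k\<close>)
  then have diff: "(\<lambda>x. ?F (chart_inv TQ i x)) differentiable (at (chart_map TQ i w))"
    and D: "frechet_derivative (\<lambda>x. ?F (chart_inv TQ i x)) (at (chart_map TQ i w)) = fst"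
    by (auto simp: differentiable_def simp flip: frechet_derivative_at)
  have "snd w \<alpha> i = tangent_map TQ Q fst w (\<Gamma> \<alpha> w) i"
    using \<Gamma> pts by (simp add: SOPDE_def)
  also have "\<dots> = frechet_derivative (\<lambda>x. ?F (chart_inv TQ ?j x)) (at (chart_map TQ ?j w)) (\<Gamma> \<alpha> w ?j)"
    using w by (simp add: tangent_map_def Let_def chart_dom_T1k)
  also have "\<dots> = fst (frechet_derivative (transition TQ ?j i) (at (chart_map TQ ?j w)) (\<Gamma> \<alpha> w ?j))"
    using frechet_derivative_change_chart[OF j w, of ?F, OF diff] by (simp add: D)
  also have "\<dots> = fst (\<Gamma> \<alpha> w i)"
    using tangent_space_change_chart[OF tangent j w] by simp
  finally show ?thesis by simp
qed

end

section \<open>The Euler--Lagrange expression\<close>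

lemma bounded_linear_zero_axis:
  "bounded_linear (\<lambda>a. (0, axis i a) :: 'b::real_normed_vector \<times> ('a::euclidean_space ^'k))"
  by (intro bounded_linear_Pair bounded_linear_zero bounded_linear_axis)

lemma linear_Pair_axis:
  fixes f :: "'a::real_vector \<times> ('b::euclidean_space ^'k) \<Rightarrow> 'c::real_vector"
  assumes "linear f"
  shows "f (a, b) = f (a, 0) + (\<Sum>i\<in>UNIV. f (0, axis i (b $ i)))"
proof -
  have "(a, b) = (a, 0) + (\<Sum>i\<in>UNIV. (0, axis i (b $ i)))"
    by (simp add: prod_eq_iff fst_sum snd_sum sum_axis)
  then show ?thesis
    by (simp add: linear_add[OF assms] linear_sum[OF assms])
qed

text \<open>The first derivative is linear in its direction at all points near \<open>x\<close>, so
  additivity and homogeneity hold as identities of functions there and survive differentiation. This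
  makes the Euler--Lagrange expression linear.\<close>

lemma linear_second_derivative_direction:
  fixes f :: "'a::euclidean_space \<Rightarrow> 'b::real_normed_vector"
  assumes S: "open S" "x \<in> S" and f: "smooth_on S f" and g: "linear g"
  shows "linear (\<lambda>a. frechet_derivative (\<lambda>y. frechet_derivative f (at y) (g a)) (at x) d)"
proof (rule linearI)
  let ?D = "\<lambda>a y. frechet_derivative f (at y) (g a)"
  have D: "(?D a has_derivative frechet_derivative (?D a) (at x)) (at x)" for a
    by (rule frechet_derivative_worksI
        [OF smooth_on_imp_differentiable[OF smooth_on_frechet_derivative[OF f] S(2)]])
  have lin: "linear (frechet_derivative f (at y))" if "y \<in> S" for y
    using smooth_on_imp_differentiable[OF f that] by (rule linear_frechet_derivative)
  fix a b :: 'c and c :: real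
  have "frechet_derivative (?D (a + b)) (at x) = frechet_derivative (\<lambda>y. ?D a y + ?D b y) (at x)"
    using S by (rule frechet_derivative_cong_open) (simp add: linear_add[OF g] linear_add[OF lin])
  then show "frechet_derivative (?D (a + b)) (at x) d =
      frechet_derivative (?D a) (at x) d + frechet_derivative (?D b) (at x) d"
    by (simp flip: frechet_derivative_at[OF has_derivative_add[OF D D]])
  have "frechet_derivative (?D (c *\<^sub>R a)) (at x) = frechet_derivative (\<lambda>y. c *\<^sub>R ?D a y) (at x)"
    using S by (rule frechet_derivative_cong_open) (simp add: linear_cmul[OF g] linear_cmul[OF lin])
  then show "frechet_derivative (?D (c *\<^sub>R a)) (at x) d = c *\<^sub>R frechet_derivative (?D a) (at x) d"
    by (simp flip: frechet_derivative_at[OF has_derivative_scaleR_right[OF D]])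
qed

text \<open>
  In coordinates this is \<open>(\<Gamma>\<^sub>\<alpha> (\<partial>L/\<partial>u\<^sup>A\<^sub>\<alpha>) - \<partial>L/\<partial>q\<^sup>A) a\<^sup>A\<close>, with the sum over \<open>\<alpha>\<close>.
\<close>

definition euler_lagrange ::
    "('q, 'i, real^'n) atlas \<Rightarrow> (('q, 'i, 'n, 'k::finite) t1k \<Rightarrow> real) \<Rightarrow>
     ('k \<Rightarrow> ('q, 'i, 'n, 'k) t1k \<Rightarrow> 'i \<Rightarrow> ('n, 'k) t1k_coords) \<Rightarrow>
     'i \<Rightarrow> ('q, 'i, 'n, 'k) t1k \<Rightarrow> real^'n \<Rightarrow> real" where
  "euler_lagrange Q L \<Gamma> i w a = (let \<l> = \<lambda>x. L (chart_inv (T1k Q) i x); x = chart_map (T1k Q) i w in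
     (\<Sum>\<alpha>\<in>UNIV. frechet_derivative (\<lambda>y. frechet_derivative \<l> (at y) (0, axis \<alpha> a)) (at x) (\<Gamma> \<alpha> w i))
       - frechet_derivative \<l> (at x) (a, 0))"

context smooth_base
begin

section \<open>The Lagrangian and lift conditions in coordinates\<close>

lemma differential_vertical:
  fixes L :: "('q, 'i, 'n, 'k) t1k \<Rightarrow> real"
  assumes "smooth_function TQ L" "w \<in> chart_dom TQ i" "z \<in> tangent_space Q (fst w)"
  shows "differential TQ L w (\<lambda>i. (0, axis \<alpha> (z i))) =
    frechet_derivative (\<lambda>x. L (chart_inv TQ i x)) (at (chart_map TQ i w)) (0, axis \<alpha> (z i))"
proof -
  have "w \<in> points TQ" using assms(2) by (auto simp: points_def)
  then show ?thesis
    using differential_in_chart[OF assms(1) vertical_in_tangent_space assms(2)] assms(3) by blast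
qed

text \<open>\<open>S_tensor\<close> turns a tangent vector of the bundle into the vertical lift of
  its base part, which is again tangent; so its differential may be computed in chart
  \<open>i\<close>.\<close>

lemma theta_in_chart:
  assumes L: "smooth_function TQ L" and w: "w \<in> chart_dom TQ i"
  shows "theta Q L \<alpha> w (tangent_of TQ i w e) =
    frechet_derivative (\<lambda>x. L (chart_inv TQ i x)) (at (chart_map TQ i w)) (0, axis \<alpha> (fst e))"
proof -
  have "S_tensor \<alpha> (tangent_of TQ i w e) = (\<lambda>j. (0, axis \<alpha> (fst (tangent_of TQ i w e j))))"
    by (simp add: S_tensor_def axis_def)
  moreover have "w \<in> points TQ" using w by (auto simp: points_def)
  ultimately show ?thesis
    using differential_vertical[OF L w fst_in_tangent_space[OF _ tangent_of_in_tangent_space[OF w]]] w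
    by (simp add: theta_def)
qed

lemma vertical_lift_in_chart:
  assumes L: "smooth_function TQ L" and w: "w \<in> chart_dom TQ i"
    and Z: "Z (fst w) \<in> tangent_space Q (fst w)"
  shows "apply_field TQ (vertical_lift Q \<alpha> Z) L w =
    frechet_derivative (\<lambda>x. L (chart_inv TQ i x)) (at (chart_map TQ i w)) (0, axis \<alpha> (Z (fst w) i))"
proof -
  \<comment> \<open>The default 0 outside the chart domain agrees with the vanishing of the
    components of \<open>Z\<close> there.\<close>
  have "vertical_lift Q \<alpha> Z w = (\<lambda>j. (0, axis \<alpha> (Z (fst w) j)))"
    using base.tangent_space_outside[OF Z]
    by (auto simp: vertical_lift_def case_prod_beta axis_def fun_eq_iff zero_prod_def vec_eq_iff)
  then show ?thesis
    using differential_vertical[OF L w Z] by (simp add: apply_field_def)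
qed

text \<open>The Lie derivative contributes a second-derivative term and a term in the variation of
  the base part u_\<alpha> of \<open>\<Gamma> \<alpha>\<close>. The latter terms sum to the fibre
  part of dL(v) and cancel it.\<close>

lemma lagrangian_expression_eq:
  fixes \<Gamma> :: "'k \<Rightarrow> ('q, 'i, 'n, 'k) t1k \<Rightarrow> 'i \<Rightarrow> ('n, 'k) t1k_coords"
  assumes L: "smooth_function TQ L" and \<Gamma>: "SOPDE Q \<Gamma>"
    and w: "w \<in> points TQ" and v: "v \<in> tangent_space TQ w"
  defines "i \<equiv> chart_at TQ w"
  shows "(\<Sum>\<alpha>\<in>UNIV. lie_derivative TQ (\<Gamma> \<alpha>) (theta Q L \<alpha>) w v) - differential TQ L w v =
    euler_lagrange Q L \<Gamma> i w (fst (v i))"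
proof -
  let ?l = "\<lambda>x. L (chart_inv TQ i x)" and ?x = "chart_map TQ i w"
  let ?D = "frechet_derivative ?l (at ?x)"
  have wi: "w \<in> chart_dom TQ i" using chart_at_in[OF w] by (simp add: i_def)
  have lin: "linear ?D"
    using smooth_function_differentiable[OF L wi] by (rule linear_frechet_derivative)
  \<comment> \<open>The base part of \<open>\<Gamma> \<alpha>\<close> is the linear coordinate
    u_\<alpha>, and so is its own derivative.\<close>
  have fstD: "fst (frechet_derivative (\<lambda>y. \<Gamma> \<alpha> (chart_inv TQ i y) i) (at ?x) e) = snd e $ \<alpha>"
    for \<alpha> e
  proof -
    let ?G = "\<lambda>y. \<Gamma> \<alpha> (chart_inv TQ i y) i"
    have "smooth_on (chart_map TQ i ` (chart_dom TQ i \<inter> points TQ)) ?G"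
      using \<Gamma> by (simp add: SOPDE_def vector_field_on_def)
    then have "?G differentiable (at ?x)"
      by (rule smooth_on_imp_differentiable) (use w wi in auto)
    then have "((\<lambda>y. fst (?G y)) has_derivative (\<lambda>e. fst (frechet_derivative ?G (at ?x) e))) (at ?x)"
      by (intro bounded_linear.has_derivative[OF bounded_linear_fst] frechet_derivative_worksI)
    then have "((\<lambda>y. snd y $ \<alpha>) has_derivative (\<lambda>e. fst (frechet_derivative ?G (at ?x) e))) (at ?x)"
      by (rule has_derivative_transform_within_open[OF _ open_chart_image[of i]])
        (use wi in \<open>auto simp: SOPDE_fst[OF \<Gamma>] snd_chart_map_T1k\<close>)
    moreover have "((\<lambda>y. snd y $ \<alpha>) has_derivative (\<lambda>e. snd e $ \<alpha>)) (at ?x)"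
      by (intro bounded_linear_imp_has_derivative bounded_linear_compose[OF bounded_linear_vec_nth]
          bounded_linear_snd)
    ultimately have "(\<lambda>e. fst (frechet_derivative ?G (at ?x) e)) = (\<lambda>e. snd e $ \<alpha>)"
      by (rule has_derivative_unique)
    then show ?thesis by (rule fun_cong)
  qed
  have "lie_derivative TQ (\<Gamma> \<alpha>) (theta Q L \<alpha>) w v =
      frechet_derivative (\<lambda>y. frechet_derivative ?l (at y) (0, axis \<alpha> (fst (v i)))) (at ?x) (\<Gamma> \<alpha> w i)
      + ?D (0, axis \<alpha> (snd (v i) $ \<alpha>))" for \<alpha>
  proof -
    have "frechet_derivative
          (\<lambda>y. theta Q L \<alpha> (chart_inv TQ i y) (tangent_of TQ i (chart_inv TQ i y) (v i))) (at ?x) =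
        frechet_derivative (\<lambda>y. frechet_derivative ?l (at y) (0, axis \<alpha> (fst (v i)))) (at ?x)"
      by (rule frechet_derivative_cong_open[OF open_chart_image[of i]])
        (use wi in \<open>auto simp: theta_in_chart[OF L]\<close>)
    then show ?thesis
      by (simp add: lie_derivative_def Let_def theta_in_chart[OF L wi] fstD flip: i_def)
  qed
  moreover have "differential TQ L w v = ?D (fst (v i), 0) + (\<Sum>\<alpha>\<in>UNIV. ?D (0, axis \<alpha> (snd (v i) $ \<alpha>)))"
    using differential_in_chart[OF L v wi] linear_Pair_axis[OF lin, of "fst (v i)" "snd (v i)"] by simp
  ultimately show ?thesis
    by (simp add: euler_lagrange_def Let_def sum.distrib)
qed

text \<open>The product rule gives a second-derivative term and a term in the derivative of
  \<open>Z\<close> along u_\<alpha>. Summed over \<alpha>, the latter is the fibre contribution of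
  the complete lift, leaving \<open>Z\<close> itself as the direction.\<close>

lemma lift_expression_eq:
  fixes \<Gamma> :: "'k \<Rightarrow> ('q, 'i, 'n, 'k) t1k \<Rightarrow> 'i \<Rightarrow> ('n, 'k) t1k_coords"
  assumes L: "smooth_function TQ L" and \<Gamma>: "SOPDE Q \<Gamma>"
    and Z: "vector_field_on Q W Z" and w: "w \<in> points TQ" "fst w \<in> W"
  defines "i \<equiv> chart_at TQ w"
  shows "(\<Sum>\<alpha>\<in>UNIV. apply_field TQ (\<Gamma> \<alpha>) (apply_field TQ (vertical_lift Q \<alpha> Z) L) w)
      - apply_field TQ (complete_lift Q Z) L w =
    euler_lagrange Q L \<Gamma> i w (Z (fst w) i)"
proof -
  let ?l = "\<lambda>x. L (chart_inv TQ i x)" and ?x = "chart_map TQ i w"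
  let ?D = "frechet_derivative ?l (at ?x)"
  let ?U = "chart_map Q i ` (chart_dom Q i \<inter> W)"
  let ?z = "\<lambda>x. Z (chart_inv Q i x) i"
  let ?Dz = "frechet_derivative ?z (at (chart_map Q i (fst w)))"
  have wi: "w \<in> chart_dom TQ i" using chart_at_in[OF w(1)] by (simp add: i_def)
  then have qi: "fst w \<in> chart_dom Q i" by (simp add: chart_dom_T1k)
  have lin: "linear ?D"
    using smooth_function_differentiable[OF L wi] by (rule linear_frechet_derivative)
  have tangent: "Z p \<in> tangent_space Q p" if "p \<in> W" for p
    using Z that by (auto simp: vector_field_on_def)
  have openU: "open (?U \<times> (UNIV :: ((real^'n)^'k) set))"
    using Z by (intro open_Times open_UNIV base.open_chart_image_openin) (simp add: vector_field_on_def)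
  have xU: "?x \<in> ?U \<times> UNIV"
    using qi w(2) by (auto simp: chart_map_T1k)
  have "smooth_on ?U ?z"
    using Z by (simp add: vector_field_on_def)
  then have "(?z has_derivative ?Dz) (at (fst ?x))"
    using qi w(2) by (auto simp: chart_map_T1k intro!: frechet_derivative_worksI
        intro: smooth_on_imp_differentiable)
  then have "((\<lambda>y. ?z (fst y)) has_derivative (\<lambda>d. ?Dz (fst d))) (at ?x)"
    by (rule has_derivative_compose[OF bounded_linear_imp_has_derivative[OF bounded_linear_fst]])
  then have h: "((\<lambda>y. (0, axis \<alpha> (?z (fst y))) :: ('n, 'k) t1k_coords) has_derivative
      (\<lambda>d. (0, axis \<alpha> (?Dz (fst d))))) (at ?x)" for \<alpha>
    by (rule bounded_linear.has_derivative[OF bounded_linear_zero_axis])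
  have "apply_field TQ (\<Gamma> \<alpha>) (apply_field TQ (vertical_lift Q \<alpha> Z) L) w =
      frechet_derivative (\<lambda>y. frechet_derivative ?l (at y) (0, axis \<alpha> (Z (fst w) i))) (at ?x) (\<Gamma> \<alpha> w i)
      + ?D (0, axis \<alpha> (?Dz (snd w \<alpha> i)))" for \<alpha>
  proof -
    \<comment> \<open>To differentiate, the coordinate formula must hold on a neighbourhood: the
      part of the chart lying over \<open>W\<close>, where \<open>Z\<close> is tangent.\<close>
    have "frechet_derivative (\<lambda>y. apply_field TQ (vertical_lift Q \<alpha> Z) L (chart_inv TQ i y)) (at ?x) =
        frechet_derivative (\<lambda>y. frechet_derivative ?l (at y) (0, axis \<alpha> (?z (fst y)))) (at ?x)"
    proof (rule frechet_derivative_cong_open[OF openU xU])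
      fix y assume "y \<in> ?U \<times> (UNIV :: ((real^'n)^'k) set)"
      then obtain q u where y: "y = (chart_map Q i q, u)" "q \<in> chart_dom Q i" "q \<in> W" by auto
      then have "y \<in> chart_map TQ i ` chart_dom TQ i"
        using chart_image_T1k[of i i] by auto
      then obtain w' where w': "w' \<in> chart_dom TQ i" "y = chart_map TQ i w'" by auto
      then have "fst w' = q"
        using y chart_inv_T1k[OF y(2), of u] by (metis chart_inv_chart_map fst_conv)
      then show "apply_field TQ (vertical_lift Q \<alpha> Z) L (chart_inv TQ i y) =
          frechet_derivative ?l (at y) (0, axis \<alpha> (?z (fst y)))"
        using vertical_lift_in_chart[OF L w'(1), of Z] tangent[of q] w' y(2,3)
        by (simp add: fst_chart_map_T1k)
    qed
    moreover have "((\<lambda>y. frechet_derivative ?l (at y) (0, axis \<alpha> (?z (fst y)))) has_derivative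
        (\<lambda>d. frechet_derivative (\<lambda>y. frechet_derivative ?l (at y) (0, axis \<alpha> (?z (fst ?x)))) (at ?x) d
          + ?D (0, axis \<alpha> (?Dz (fst d))))) (at ?x)"
      by (rule has_derivative_frechet_derivative_apply[OF open_chart_image _ has_derivative_ident _ h])
        (use L wi in \<open>auto simp: smooth_function_def\<close>)
    ultimately show ?thesis
      using qi by (simp add: apply_field_def differential_def Let_def SOPDE_fst[OF \<Gamma> wi] chart_map_T1k
          flip: i_def frechet_derivative_at)
  qed
  \<comment> \<open>In this chart the complete lift has base part \<open>Z\<close> and fibre parts
    the derivatives of \<open>Z\<close> along u_\<alpha>; linearity of dL separates them.\<close>
  moreover have "apply_field TQ (complete_lift Q Z) L w =
      ?D (Z (fst w) i, 0) + (\<Sum>\<alpha>\<in>UNIV. ?D (0, axis \<alpha> (?Dz (snd w \<alpha> i))))"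
    using qi linear_Pair_axis[OF lin, of "Z (fst w) i" "\<chi> \<alpha>. ?Dz (snd w \<alpha> i)"]
    by (simp add: apply_field_def differential_def Let_def complete_lift_def case_prod_beta flip: i_def)
  ultimately show ?thesis
    by (simp add: euler_lagrange_def Let_def sum.distrib)
qed

lemma linear_euler_lagrange:
  fixes L :: "('q, 'i, 'n, 'k) t1k \<Rightarrow> real"
  assumes L: "smooth_function TQ L" and w: "w \<in> chart_dom TQ i"
  shows "linear (euler_lagrange Q L \<Gamma> i w)"
proof -
  let ?l = "\<lambda>x. L (chart_inv TQ i x)" and ?x = "chart_map TQ i w"
  have "linear (\<lambda>a. frechet_derivative (\<lambda>y. frechet_derivative ?l (at y) (0, axis \<alpha> a)) (at ?x) d)"
    for \<alpha> d
    by (rule linear_second_derivative_direction[OF open_chart_image[of i] _ _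
          bounded_linear.linear[OF bounded_linear_zero_axis]])
      (use L w in \<open>auto simp: smooth_function_def\<close>)
  moreover have "linear (\<lambda>a. frechet_derivative ?l (at ?x) (a, 0))"
    using linear_compose[OF _ linear_frechet_derivative[OF smooth_function_differentiable[OF L w]],
        of "\<lambda>a. (a, 0)"]
    by (simp add: o_def linear_iff)
  ultimately show ?thesis
    unfolding euler_lagrange_def[abs_def] Let_def by (intro linear_compose_sub linear_compose_sum ballI)
qed

lemma lagrangian_for_iff:
  fixes \<Gamma> :: "'k \<Rightarrow> ('q, 'i, 'n, 'k) t1k \<Rightarrow> 'i \<Rightarrow> ('n, 'k) t1k_coords"
  assumes L: "smooth_function TQ L" and \<Gamma>: "SOPDE Q \<Gamma>"
  shows "lagrangian_for Q L \<Gamma> \<longleftrightarrow>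
    (\<forall>w\<in>points TQ. \<forall>a. euler_lagrange Q L \<Gamma> (chart_at TQ w) w a = 0)"
proof -
  \<comment> \<open>Every \<open>a\<close> is the base part of a tangent vector, for instance one
    with zero fibre part in the chosen chart.\<close>
  have "\<exists>v\<in>tangent_space TQ w. fst (v (chart_at TQ w)) = a" if "w \<in> points TQ" for w a
    using chart_at_in[OF that] tangent_of_in_tangent_space
    by (intro bexI[of _ "tangent_of TQ (chart_at TQ w) w (a, 0)"]) auto
  then show ?thesis
    unfolding lagrangian_for_def by (auto simp: lagrangian_expression_eq[OF L \<Gamma>]) metis
qed

end

section \<open>Equivalence of the three conditions\<close>

theorem proposition4p3:
  fixes Q :: "('q, 'i, real^'n) atlas"
    and L :: "('q, 'i, 'n, 'k::finite) t1k \<Rightarrow> real"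
    and \<Gamma> :: "'k \<Rightarrow> ('q, 'i, 'n, 'k) t1k \<Rightarrow> 'i \<Rightarrow> ('n, 'k) t1k_coords"
  assumes "smooth_manifold Q"
    and "smooth_function (T1k Q) L"
    and "regular_lagrangian Q L"
    and "SOPDE Q \<Gamma>"
  shows "(lagrangian_for Q L \<Gamma> \<longleftrightarrow>
          (\<forall>Z. vector_field_on Q (points Q) Z \<longrightarrow>
             (\<forall>w\<in>points (T1k Q).
                (\<Sum>\<alpha>\<in>UNIV. apply_field (T1k Q) (\<Gamma> \<alpha>)
                    (apply_field (T1k Q) (vertical_lift Q \<alpha> Z) L) w)
                  - apply_field (T1k Q) (complete_lift Q Z) L w = 0)))
       \<and> (lagrangian_for Q L \<Gamma> \<longleftrightarrow>
          (\<forall>W Z. local_frame Q W Z \<longrightarrow>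
             (\<forall>A. \<forall>w\<in>points (T1k Q). fst w \<in> W \<longrightarrow>
                (\<Sum>\<alpha>\<in>UNIV. apply_field (T1k Q) (\<Gamma> \<alpha>)
                    (apply_field (T1k Q) (vertical_lift Q \<alpha> (Z A)) L) w)
                  - apply_field (T1k Q) (complete_lift Q (Z A)) L w = 0)))"
    (is "(_ \<longleftrightarrow> ?ii) \<and> (_ \<longleftrightarrow> ?iii)")
proof -
  interpret smooth_base Q "TYPE('k)" using assms(1) by unfold_locales
  let ?E = "\<lambda>w. euler_lagrange Q L \<Gamma> (chart_at TQ w) w"
  note lagrangian = lagrangian_for_iff[OF assms(2,4)]
  note lift = lift_expression_eq[OF assms(2,4)]
  have base_chart: "fst w \<in> chart_dom Q (chart_at TQ w)" if "w \<in> points TQ" for w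
    using chart_at_in[OF that] by (simp add: chart_dom_T1k)
  then have base_point: "fst w \<in> points Q" if "w \<in> points TQ" for w
    unfolding points_def[of Q] using that by blast
  show ?thesis
  proof (intro conjI iffI)
    show ?ii if "lagrangian_for Q L \<Gamma>"
      using that lift base_point by (simp add: lagrangian)
    show ?iii if "lagrangian_for Q L \<Gamma>"
    proof (intro allI impI ballI)
      fix W Z A w assume "local_frame Q W Z" and w: "w \<in> points TQ" "fst w \<in> W"
      then have "vector_field_on Q W (Z A)" by (simp add: local_frame_def)
      from lift[OF this w] show "(\<Sum>\<alpha>\<in>UNIV. apply_field TQ (\<Gamma> \<alpha>)
          (apply_field TQ (vertical_lift Q \<alpha> (Z A)) L) w)
          - apply_field TQ (complete_lift Q (Z A)) L w = 0"
        using that w(1) by (simp add: lagrangian)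
    qed
    show "lagrangian_for Q L \<Gamma>" if ?ii
      unfolding lagrangian
    proof (intro ballI allI)
      fix w a assume w: "w \<in> points TQ"
      \<comment> \<open>Condition (ii) speaks of global fields, hence the cut-off field with value
        \<open>a\<close> at the base point.\<close>
      obtain X where X: "vector_field_on Q (points Q) X" "X (fst w) (chart_at TQ w) = a"
        using exists_vector_field_with_value[OF assms(1) base_chart[OF w]] .
      then show "?E w a = 0"
        using that lift[OF X(1) w base_point[OF w]] w by simp
    qed
    show "lagrangian_for Q L \<Gamma>" if ?iii
      unfolding lagrangian
    proof (intro ballI allI)
      fix w and a :: "real^'n" assume w: "w \<in> points TQ"
      let ?i = "chart_at TQ w"
      \<comment> \<open>The coordinate frame of the chosen chart: its components at the base point
        are the standard basis, from which linearity reaches \<open>a\<close>.\<close>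
      let ?Z = "\<lambda>A p. tangent_of Q ?i p (axis A 1)"
      note frame = local_frame_coordinate[OF assms(1), of ?i]
      then have "vector_field_on Q (chart_dom Q ?i) (?Z A)" for A
        by (simp add: local_frame_def)
      then have "?E w (?Z A (fst w) ?i) = 0" for A
        using that[rule_format, OF frame w base_chart[OF w], of A]
          lift[of "chart_dom Q ?i" "?Z A" w] w base_chart[OF w] by simp
      then have "?E w (axis A 1) = 0" for A
        using base_chart[OF w] by simp
      moreover have "a = (\<Sum>A\<in>UNIV. a $ A *\<^sub>R axis A 1)"
        using basis_expansion[of a] by (simp add: scalar_mult_eq_scaleR)
      moreover have "linear (?E w)"
        using linear_euler_lagrange[OF assms(2) chart_at_in[OF w]] .
      ultimately show "?E w a = 0"
        using linear_sum[of "?E w" "\<lambda>A. a $ A *\<^sub>R axis A 1" UNIV] by (simp add: linear_cmul)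
    qed
  qed
qed

end
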